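(* For all integers $n\geq 0$ and $m\geq 0$, \[ B_{7,11}\left(7^{12m}n+\frac{2\cdot 7^{12m}-2}{3}\right)\equiv 3^m B_{7,11}(n)\pmod{11}, \] and \[ B_{7,11}\left(7^{12m+11}(7n+k)+\frac{2\cdot 7^{12m+11}-2}{3}\right)\equiv 0\pmod{11}\quad\text{for } k\in\{1,5,6\}. \]
   Context: For integers $s,t>1$, an $(s,t)$-regular bipartition of $n$ is a pair $(\lambda,\mu)$ of partitions with total sum of parts $n$ such that no part of $\lambda$ is divisible by $s$ and no part of $\mu$ is divisible by $t$. $B_{s,t}(n)$ denotes the number of $(s,t)$-regular bipartitions of $n$; equivalently $\sum_{n\geq0}B_{s,t}(n)q^n=\frac{f_sf_t}{f_1^2}$, where $f_k=\prod_{m\geq1}(1-q^{mk})$. *)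

theory Defs
  imports "HOL-Library.Multiset" "HOL-Number_Theory.Cong"
begin

text \<open>A partition is the finite multiset of its (positive) parts.\<close>

definition is_partition :: "nat multiset \<Rightarrow> bool" where
  "is_partition p \<longleftrightarrow> (\<forall>x \<in># p. 0 < x)"

definition regular_partition :: "nat \<Rightarrow> nat multiset \<Rightarrow> bool" where
  "regular_partition s p \<longleftrightarrow> is_partition p \<and> (\<forall>x \<in># p. \<not> s dvd x)"

definition regular_bipartitions :: "nat \<Rightarrow> nat \<Rightarrow> nat \<Rightarrow> (nat multiset \<times> nat multiset) set" where
  "regular_bipartitions s t n =
     {(p, r). regular_partition s p \<and> regular_partition t r \<and> sum_mset p + sum_mset r = n}"

definition B :: "nat \<Rightarrow> nat \<Rightarrow> nat \<Rightarrow> nat" where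
  "B s t n = card (regular_bipartitions s t n)"

lemma size_le_sum_mset_partition: "is_partition p \<Longrightarrow> size p \<le> sum_mset p"
proof (induction p)
  case empty
  then show ?case by simp
next
  case (add x p)
  then have "0 < x" "size p \<le> sum_mset p" by (simp_all add: is_partition_def)
  then show ?case by simp
qed

lemma finite_partitions_le: "finite {p. is_partition p \<and> sum_mset p \<le> n}"
proof (rule finite_subset)
  show "finite (mset ` {xs. set xs \<subseteq> {..n} \<and> length xs \<le> n})"
    by (intro finite_imageI finite_lists_length_le finite_atMost)
  show "{p. is_partition p \<and> sum_mset p \<le> n} \<subseteq> mset ` {xs. set xs \<subseteq> {..n} \<and> length xs \<le> n}"
  proof (rule subsetI, unfold mem_Collect_eq, elim conjE)
    fix p :: "nat multiset" assume p: "is_partition p" "sum_mset p \<le> n"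
    obtain xs where xs: "p = mset xs" using ex_mset[of p] by fast
    have "length xs \<le> n"
      using order_trans[OF size_le_sum_mset_partition[OF p(1)] p(2)] unfolding xs by simp
    moreover have "x \<le> n" if "x \<in> set xs" for x
      using p(2) that member_le_sum_list[of x xs] unfolding xs by (simp add: sum_mset_sum_list)
    ultimately show "p \<in> mset ` {xs. set xs \<subseteq> {..n} \<and> length xs \<le> n}"
      unfolding xs by (intro imageI CollectI conjI subsetI) simp_all
  qed
qed

text \<open>The set counted by \<^term>\<open>B s t n\<close> is finite, so its \<^const>\<open>card\<close> is the true cardinality.\<close>

lemma finite_regular_bipartitions: "finite (regular_bipartitions s t n)"
proof (rule finite_subset)
  show "regular_bipartitions s t n \<subseteq>
      {p. is_partition p \<and> sum_mset p \<le> n} \<times> {p. is_partition p \<and> sum_mset p \<le> n}"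
  proof (rule subsetI)
    fix x assume "x \<in> regular_bipartitions s t n"
    then obtain p r where x: "x = (p, r)" and "is_partition p" "is_partition r"
      and n: "sum_mset p + sum_mset r = n"
      unfolding regular_bipartitions_def regular_partition_def by blast
    moreover have "sum_mset p \<le> n" "sum_mset r \<le> n"
      unfolding n[symmetric] by (rule le_add1, rule le_add2)
    ultimately show "x \<in> {p. is_partition p \<and> sum_mset p \<le> n} \<times> {p. is_partition p \<and> sum_mset p \<le> n}"
      by blast
  qed
qed (intro finite_cartesian_product finite_partitions_le)

end

theory Submission
  imports Defs "HOL-Computational_Algebra.Formal_Laurent_Series"
begin

unbundle fps_syntax

text \<open>
  Write \<open>f\<close> for Euler's product and \<open>f_k = f(q^k)\<close>. Since \<open>f_11 \<equiv> f^11\<close>, the generating function is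
  congruent to \<open>F = f^9 * f_7\<close> modulo 11. Put \<open>H = q * f^5 * f_7^5\<close> and \<open>G = q^2 * f * f_7^9\<close>, and let \<open>U\<close>
  extract the coefficients of \<open>q^(7 n + 4)\<close>. Over the integers
  \<open>U F = - 90 F - 882 H - 2401 G\<close>, \<open>U H = 10 F + 49 H\<close> and \<open>U G = - F\<close>; modulo 11 this gives
  \<open>U^11 F = 8 G\<close> and \<open>U^12 F = 3 F\<close>, which are the two claims, as the exponents in \<open>G\<close> avoid the residues
  1, 5, 6 modulo 7 by the pentagonal number theorem.

  For the action of \<open>U\<close>, the pentagonal number theorem splits \<open>f\<close> into four 7-sections, one of them being
  \<open>- q^2 * f_49\<close>, and Jacobi's formula for \<open>f^3\<close> gives algebraic relations between them. The product
  of \<open>f(z * q)\<close> over the seventh roots of unity \<open>z\<close> is \<open>f_7^8 / f_49\<close>; computed from the sections, it expresses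
  \<open>f_7^4\<close> as a polynomial in them. The sections of \<open>f^5\<close> and \<open>f^9\<close> selected by \<open>U\<close> then reduce to
  polynomials in \<open>f\<close> and \<open>f_7\<close>.
\<close>

section \<open>Euler's product, its pentagonal expansion and its cube\<close>

text \<open>Infinite products are handled without limits: divisibility of a difference by
  \<open>fps_X ^ n\<close> serves as congruence modulo \<open>q^n\<close>, and this turns it into a
  statement on coefficients.\<close>

lemma fps_X_power_dvd_iff: "fps_X ^ n dvd f \<longleftrightarrow> (\<forall>i<n. f $ i = 0)" for f :: "'a::comm_ring_1 fps"
proof
  assume "\<forall>i<n. f $ i = 0"
  then have "f = fps_X ^ n * fps_shift n f"
    by (intro fps_ext) (simp add: fps_X_power_mult_nth)
  then show "fps_X ^ n dvd f" by (rule dvdI)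
qed (auto simp: fps_X_power_mult_nth elim!: dvdE)

text \<open>The infinite product over all \<open>i > 0\<close> of \<open>1 - q^i\<close>.
  Coefficient \<open>n\<close> can be read off after \<open>n\<close> factors, since later factors
  are 1 modulo \<open>q^(n+1)\<close>.\<close>

definition euler_fps :: "'a::comm_ring_1 fps" where
  "euler_fps = Abs_fps (\<lambda>n. (\<Prod>i\<in>{0<..n}. 1 - fps_X ^ i) $ n)"

lemma prod_cong_dvd:
  fixes d :: "'a::comm_ring_1"
  assumes "\<And>i. i \<in> A \<Longrightarrow> d dvd f i - g i"
  shows "d dvd prod f A - prod g A"
  using assms
proof (induction A rule: infinite_finite_induct)
  case (insert x F)
  have "prod f (insert x F) - prod g (insert x F)
      = f x * (prod f F - prod g F) + (f x - g x) * prod g F"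
    using insert.hyps by (simp add: algebra_simps)
  then show ?case using insert by simp
qed auto

lemma prod_euler_stable:
  assumes "N \<le> M"
  shows "fps_X ^ Suc N dvd (\<Prod>i\<in>{0<..M}. 1 - fps_X ^ i) - (\<Prod>i\<in>{0<..N}. 1 - fps_X ^ i :: 'a::comm_ring_1 fps)"
proof -
  have eq: "{0<..M} = {0<..N} \<union> {N<..M}" using assms by auto
  have "fps_X ^ Suc N dvd (\<Prod>i\<in>{N<..M}. 1 - fps_X ^ i) - (\<Prod>i\<in>{N<..M}. 1 :: 'a fps)"
  proof (rule prod_cong_dvd)
    fix i assume "i \<in> {N<..M}"
    then show "fps_X ^ Suc N dvd (1 - fps_X ^ i) - (1 :: 'a fps)"
      by (simp add: le_imp_power_dvd del: power_Suc)
  qed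
  then have "fps_X ^ Suc N dvd (\<Prod>i\<in>{0<..N}. 1 - fps_X ^ i) * ((\<Prod>i\<in>{N<..M}. 1 - fps_X ^ i) - (1 :: 'a fps))"
    by simp
  then show ?thesis unfolding eq
    by (subst prod.union_disjoint) (auto simp: algebra_simps)
qed

lemma euler_fps_cong:
  "fps_X ^ Suc N dvd euler_fps - (\<Prod>i\<in>{0<..N}. 1 - fps_X ^ i :: 'a::comm_ring_1 fps)"
  unfolding fps_X_power_dvd_iff
proof safe
  fix n assume "n < Suc N"
  then have "fps_X ^ Suc n dvd (\<Prod>i\<in>{0<..N}. 1 - fps_X ^ i) - (\<Prod>i\<in>{0<..n}. 1 - fps_X ^ i :: 'a fps)"
    by (intro prod_euler_stable) auto
  then show "(euler_fps - (\<Prod>i\<in>{0<..N}. 1 - fps_X ^ i :: 'a fps)) $ n = 0"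
    unfolding fps_X_power_dvd_iff by (simp add: euler_fps_def)
qed

lemma euler_fps_nth_0 [simp]: "euler_fps $ 0 = 1"
  by (simp add: euler_fps_def)

section \<open>The pentagonal number theorem from Shanks' finite identity\<close>

definition triangular :: "nat \<Rightarrow> nat" where "triangular n = n * (n + 1) div 2"

lemma triangular_0 [simp]: "triangular 0 = 0" by (simp add: triangular_def)

lemma triangular_Suc [simp]: "triangular (Suc n) = triangular n + Suc n"
proof -
  have "Suc n * (Suc n + 1) = n * (n + 1) + Suc n * 2" by simp
  then show ?thesis unfolding triangular_def by (simp only: div_mult_self1)
qed

lemma double_triangular: "2 * triangular n = n * (n + 1)"
  unfolding triangular_def by simp

lemma triangular_ge: "n \<le> triangular n" by (induction n) auto

text \<open>Shanks' terms: \<open>shanks_partial\<close> makes the passage from \<open>n\<close> to \<open>n + 1\<close> telescope, and modulo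
  \<open>q ^ (n + 1)\<close> only \<open>s = 0\<close> survives, which is the truncated Euler product.\<close>

definition shanks_term :: "'a::comm_ring_1 \<Rightarrow> nat \<Rightarrow> nat \<Rightarrow> 'a" where
  "shanks_term q n s = (-1) ^ s * (\<Prod>k\<in>{s<..n}. 1 - q ^ k) * q ^ (s * n + triangular s)"

lemma shanks_term_Suc: "s \<le> n \<Longrightarrow> shanks_term q (Suc n) s = shanks_term q n s * (1 - q ^ Suc n) * q ^ s"
proof -
  assume "s \<le> n"
  then have "{s<..Suc n} = insert (Suc n) {s<..n}" by auto
  then show ?thesis by (simp add: shanks_term_def power_add algebra_simps)
qed

lemma shanks_term_Suc_right:
  "s < n \<Longrightarrow> shanks_term q n (Suc s) * (1 - q ^ Suc s) = - shanks_term q n s * q ^ (Suc s + n)"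
proof -
  assume "s < n"
  then have "{s<..n} = insert (Suc s) {Suc s<..n}" by auto
  then show ?thesis by (simp add: shanks_term_def power_add algebra_simps)
qed

lemma shanks_partial:
  "m \<le> n \<Longrightarrow> (\<Sum>s\<le>m. shanks_term q (Suc n) s - shanks_term q n s) = - shanks_term q n m * q ^ (m + n + 1)"
proof (induction m)
  case 0
  then show ?case using shanks_term_Suc[of 0 n q] by (simp add: algebra_simps)
next
  case (Suc m)
  then show ?case
    using shanks_term_Suc[of "Suc m" n q] shanks_term_Suc_right[of m n q]
    by (simp add: algebra_simps power_add)
qed

text \<open>Passing from \<open>n\<close> to \<open>n + 1\<close> adds the boundary term of
  \<open>shanks_partial\<close> and the new term \<open>s = n + 1\<close>. These two carry the
  pentagonal exponents \<open>j * (3 * j - 1) / 2\<close> for \<open>j = n + 1\<close> and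
  \<open>j = - (n + 1)\<close>.\<close>

lemma shanks:
  fixes q :: "'a::comm_ring_1"
  shows "(\<Sum>s\<le>n. shanks_term q n s)
    = 1 + (\<Sum>s<n. (-1) ^ Suc s * (q ^ (Suc s * Suc s + triangular s) + q ^ (Suc s * Suc s + triangular (Suc s))))"
proof (induction n)
  case 0
  then show ?case by (simp add: shanks_term_def)
next
  case (Suc n)
  have "(\<Sum>s\<le>Suc n. shanks_term q (Suc n) s) = (\<Sum>s\<le>n. shanks_term q n s)
      + (\<Sum>s\<le>n. shanks_term q (Suc n) s - shanks_term q n s) + shanks_term q (Suc n) (Suc n)"
    by (simp add: sum_subtractf)
  also have "\<dots> = (\<Sum>s\<le>n. shanks_term q n s)
     + (-1) ^ Suc n * (q ^ (Suc n * Suc n + triangular n) + q ^ (Suc n * Suc n + triangular (Suc n)))"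
    unfolding shanks_partial[OF order.refl] by (simp add: shanks_term_def power_add algebra_simps)
  finally show ?case by (simp add: Suc)
qed

lemma pentagonal_number_partial:
  assumes "n \<le> N"
  shows "euler_fps $ n = (1 + (\<Sum>s<N. (-1) ^ Suc s * (fps_X ^ (Suc s * Suc s + triangular s)
     + fps_X ^ (Suc s * Suc s + triangular (Suc s)))) :: 'a::comm_ring_1 fps) $ n"
proof -
  let ?P = "\<Prod>i\<in>{0<..N}. 1 - fps_X ^ i :: 'a fps"
  let ?S = "\<Sum>s\<in>{0<..N}. shanks_term (fps_X :: 'a fps) N s"
  have S: "fps_X ^ Suc N dvd ?S"
  proof (rule dvd_sum)
    fix s assume "s \<in> {0<..N}"
    then have "Suc N \<le> s * N + triangular s"
      using triangular_ge[of s] by (cases s) auto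
    then show "fps_X ^ Suc N dvd shanks_term (fps_X :: 'a fps) N s"
      unfolding shanks_term_def by (intro dvd_mult le_imp_power_dvd)
  qed
  have P: "fps_X ^ Suc N dvd euler_fps - ?P"
    by (rule euler_fps_cong)
  have "{..N} = insert 0 {0<..N}" by auto
  then have "(\<Sum>s\<le>N. shanks_term (fps_X :: 'a fps) N s) = ?P + ?S"
    by (simp add: shanks_term_def)
  then have "euler_fps - (\<Sum>s\<le>N. shanks_term (fps_X :: 'a fps) N s) = (euler_fps - ?P) - ?S"
    by simp
  with S P have "fps_X ^ Suc N dvd euler_fps - (\<Sum>s\<le>N. shanks_term (fps_X :: 'a fps) N s)"
    by (metis dvd_diff)
  then have "(euler_fps - (\<Sum>s\<le>N. shanks_term (fps_X :: 'a fps) N s)) $ n = 0"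
    using assms unfolding fps_X_power_dvd_iff by simp
  then show ?thesis unfolding shanks fps_sub_nth by (simp only: right_minus_eq)
qed

theorem pentagonal_number:
  "(euler_fps :: 'a::comm_ring_1 fps) $ n =
    (\<Sum>j | j * (3 * j - 1) = 2 * int n. if even j then 1 else -1)"
proof -
  define t :: "int \<Rightarrow> 'a" where "t j = (if j * (3 * j - 1) = 2 * int n then (if even j then 1 else -1) else 0)" for j
  \<comment> \<open>This makes the index set finite and allows the sum to run over the symmetric
    window from \<open>- n\<close> to \<open>n\<close>, where \<open>j\<close> and
    \<open>- j\<close> are then paired.\<close>
  have bound: "\<bar>j\<bar> \<le> int n" if "j * (3 * j - 1) = 2 * int n" for j :: int
  proof -
    have 1: "\<bar>j\<bar> \<le> j * j"
    proof (cases "j = 0")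
      case False
      then have "\<bar>j\<bar> * 1 \<le> \<bar>j\<bar> * \<bar>j\<bar>" by (intro mult_left_mono) auto
      then show ?thesis by simp
    qed simp
    have "j * j * 2 = 2 * int n + (j - j * j)" using that by (simp add: algebra_simps)
    with 1 show ?thesis by linarith
  qed
  have "(\<Sum>j | j * (3 * j - 1) = 2 * int n. if even j then 1 else -1) = sum t {- int n..int n}"
  proof -
    have "{j. j * (3 * j - 1) = 2 * int n} = {j \<in> {- int n..int n}. j * (3 * j - 1) = 2 * int n}"
      using bound by (auto simp: abs_le_iff) force
    then show ?thesis unfolding t_def by (subst sum.inter_filter[symmetric]) (simp_all only: finite_atLeastAtMost_int)
  qed
  also have "\<dots> = t 0 + (\<Sum>s<n. t (int (Suc s)) + t (- int (Suc s)))"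
  proof -
    have "sum t {- int m..int m} = t 0 + (\<Sum>s<m. t (int (Suc s)) + t (- int (Suc s)))" for m
    proof (induction m)
      case (Suc m)
      have "{- int (Suc m)..int (Suc m)} = insert (int (Suc m)) (insert (- int (Suc m)) {- int m..int m})" by auto
      then show ?case using Suc by (simp add: algebra_simps)
    qed auto
    then show ?thesis .
  qed
  also have "\<dots> = euler_fps $ n"
  proof -
    have tri: "int (Suc s) * (3 * int (Suc s) - 1) = 2 * int (Suc s * Suc s + triangular s)"
              "(- int (Suc s)) * (3 * (- int (Suc s)) - 1) = 2 * int (Suc s * Suc s + triangular (Suc s))" for s
      using arg_cong[OF double_triangular[of s], of int] by (simp_all add: algebra_simps)
    have "t (int (Suc s)) = ((-1) ^ Suc s * fps_X ^ (Suc s * Suc s + triangular s) :: 'a fps) $ n"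
         "t (- int (Suc s)) = ((-1) ^ Suc s * fps_X ^ (Suc s * Suc s + triangular (Suc s)) :: 'a fps) $ n" for s
      unfolding t_def tri by (auto simp: minus_one_power_iff simp del: triangular_Suc of_nat_Suc)
    moreover have "t 0 = (1 :: 'a fps) $ n" by (simp add: t_def)
    ultimately show ?thesis
      unfolding pentagonal_number_partial[OF order.refl] by (simp add: fps_sum_nth distrib_left del: triangular_Suc of_nat_Suc)
  qed
  finally show ?thesis ..
qed

section \<open>Jacobi's formula for the cube from a finite triple product\<close>

lemma fps_X_power_dvd_cancel:
  fixes g h :: "'a::idom fps"
  assumes "g $ 0 \<noteq> 0" "fps_X ^ n dvd g * h"
  shows "fps_X ^ n dvd h"
  unfolding fps_X_power_dvd_iff
proof safe
  fix i assume "i < n"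
  then show "h $ i = 0"
  proof (induction i rule: less_induct)
    case (less i)
    have "0 = (g * h) $ i" using assms(2) less.prems by (simp add: fps_X_power_dvd_iff)
    also have "\<dots> = (\<Sum>j\<in>{0..i}. g $ j * h $ (i - j))" by (rule fps_mult_nth)
    \<comment> \<open>By induction the coefficients of \<open>h\<close> below \<open>i\<close>
      vanish, so only \<open>g $ 0 * h $ i\<close> is left.\<close>
    also have "\<dots> = (\<Sum>j\<in>{0}. g $ j * h $ (i - j))"
      using less by (intro sum.mono_neutral_right) auto
    finally show ?case using assms(1) by simp
  qed
qed

text \<open>\<open>jacobi_coeff q n k\<close> is the coefficient of \<open>z ^ k\<close> in
  \<open>(1 - 1 / z) * (\<Prod>i=1..n. (1 - z * q ^ i) * (1 - q ^ i / z))\<close>. The coefficients satisfy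
  \<open>c (- 1 - k) = - c k\<close>, so \<open>k \<ge> 0\<close> suffices, and \<open>sum_jacobi_coeff\<close> is the derivative at \<open>z = 1\<close>.\<close>

primrec jacobi_coeff :: "'a::comm_ring_1 \<Rightarrow> nat \<Rightarrow> nat \<Rightarrow> 'a" where
  "jacobi_coeff q 0 k = (if k = 0 then 1 else 0)"
| "jacobi_coeff q (Suc n) k = (1 + q ^ (2 * Suc n)) * jacobi_coeff q n k
     - q ^ Suc n * (if k = 0 then - jacobi_coeff q n 0 else jacobi_coeff q n (k - 1))
     - q ^ Suc n * jacobi_coeff q n (Suc k)"

lemma jacobi_coeff_eq_0: "n < k \<Longrightarrow> jacobi_coeff q n k = 0"
  by (induction n arbitrary: k) auto

lemma jacobi_coeff_diag: "jacobi_coeff q n n = (-1) ^ n * q ^ triangular n"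
  by (induction n) (auto simp: jacobi_coeff_eq_0 power_add algebra_simps)

lemma sum_jacobi_coeff:
  "n \<le> N \<Longrightarrow> (\<Sum>k\<le>N. of_nat (2 * k + 1) * jacobi_coeff q n k) = (\<Prod>i\<in>{0<..n}. 1 - q ^ i)\<^sup>2"
proof (induction n arbitrary: N)
  case 0
  have "(\<Sum>k\<le>N. of_nat (2 * k + 1) * jacobi_coeff q 0 k) = (\<Sum>k\<in>{0}. of_nat (2 * k + 1) * jacobi_coeff q 0 k)"
    by (intro sum.mono_neutral_right) auto
  then show ?case by simp
next
  case (Suc n)
  \<comment> \<open>Shifting \<open>k\<close> by one changes the weight \<open>2 * k + 1\<close> by
    2, so each shifted sum is \<open>p\<close> up to a correction. Here \<open>s\<close> is the
    unweighted sum and \<open>c\<close> the coefficient at 0; the corrections of the two shifts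
    cancel.\<close>
  have gen: "(1 + y\<^sup>2) * p - y * (- c + p + 2 * s) - y * (p - 2 * s + c) = (1 - y)\<^sup>2 * p" for y p c s :: 'a
    by (simp add: power2_eq_square algebra_simps)
  let ?c = "jacobi_coeff q n" and ?P = "\<Prod>i\<in>{0<..n}. 1 - q ^ i"
  obtain M where M: "N = Suc M" "n \<le> M" using Suc.prems by (cases N) auto
  have S: "(\<Sum>k\<le>K. of_nat (2 * k + 1) * ?c k) = ?P\<^sup>2" if "n \<le> K" for K using Suc.IH that .
  have z: "?c (Suc M) = 0" "?c (Suc (Suc M)) = 0" using M by (auto intro!: jacobi_coeff_eq_0)
  define S0 where "S0 = (\<Sum>k\<le>M. ?c k)"
  have split: "(\<Sum>k\<le>Suc M. g k) = g 0 + (\<Sum>k\<le>M. g (Suc k))" for g :: "nat \<Rightarrow> 'a"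
    by (rule sum.atMost_Suc_shift)
  have down: "(\<Sum>k\<le>N. of_nat (2 * k + 1) * (if k = 0 then - ?c 0 else ?c (k - 1)))
      = - ?c 0 + ?P\<^sup>2 + 2 * S0"
    unfolding M split S[OF M(2), symmetric] S0_def
    by (simp add: sum_distrib_left sum.distrib[symmetric] algebra_simps)
  have "S0 = ?c 0 + (\<Sum>k\<le>M. ?c (Suc k))"
    using split[of ?c] z by (simp add: S0_def)
  moreover have "?P\<^sup>2 = ?c 0 + (\<Sum>k\<le>M. of_nat (2 * Suc k + 1) * ?c (Suc k))"
    using split[of "\<lambda>k. of_nat (2 * k + 1) * ?c k"] S[of "Suc M"] M by simp
  ultimately have up: "(\<Sum>k\<le>N. of_nat (2 * k + 1) * ?c (Suc k)) = ?P\<^sup>2 - 2 * S0 + ?c 0"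
    unfolding M using z by (simp add: sum.distrib algebra_simps flip: sum_distrib_left)
  have "{0<..Suc n} = insert (Suc n) {0<..n}" by auto
  then have prod: "(\<Prod>i\<in>{0<..Suc n}. 1 - q ^ i) = (1 - q ^ Suc n) * ?P" by simp
  have main: "(\<Sum>k\<le>N. of_nat (2 * k + 1) * jacobi_coeff q (Suc n) k)
      = (1 + q ^ (2 * Suc n)) * (\<Sum>k\<le>N. of_nat (2 * k + 1) * ?c k)
       - q ^ Suc n * (\<Sum>k\<le>N. of_nat (2 * k + 1) * (if k = 0 then - ?c 0 else ?c (k - 1)))
       - q ^ Suc n * (\<Sum>k\<le>N. of_nat (2 * k + 1) * ?c (Suc k))"
    unfolding sum_distrib_left sum_subtractf[symmetric]
    by (intro sum.cong refl) (simp only: jacobi_coeff.simps algebra_simps)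
  have "n \<le> N" using M by simp
  then have "(\<Sum>k\<le>N. of_nat (2 * k + 1) * ?c k) = ?P\<^sup>2" by (rule S)
  then show ?case
    unfolding main prod down up power_even_eq[of q] power_mult_distrib by (simp only: gen)
qed

text \<open>Up to sign and a power of \<open>q\<close> the coefficient is the Gaussian binomial with
  upper index \<open>2 * n + 1\<close> and lower index \<open>n - k\<close>. It is stated
  cross-multiplied to avoid division. In the induction the three terms of the recurrence are brought
  to the same products \<open>P\<close>.\<close>

lemma jacobi_coeff_prod:
  fixes q :: "'a::comm_ring_1"
  defines "P \<equiv> \<lambda>m. \<Prod>i\<in>{0<..m}. 1 - q ^ i"
  shows "k \<le> n \<Longrightarrow> jacobi_coeff q n k * P (n - k) * P (n + k + 1) = (-1) ^ k * q ^ triangular k * P (2 * n + 1)"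
proof (induction n arbitrary: k)
  case (Suc n)
  have P_Suc: "P (Suc m) = (1 - q ^ Suc m) * P m" for m
  proof -
    have "{0<..Suc m} = insert (Suc m) {0<..m}" by auto
    then show ?thesis by (simp add: P_def)
  qed
  show ?case
  proof (cases "k = Suc n")
    case True
    then show ?thesis using jacobi_coeff_diag[of q "Suc n"]
      by (simp add: P_def mult_2 del: jacobi_coeff.simps triangular_Suc)
  next
    case False
    then obtain d where n: "n = k + d" using Suc.prems by (metis le_Suc_eq le_Suc_ex)
    define D where "D = P (2 * n + 1)"
    \<comment> \<open>In terms of \<open>q\<close>, \<open>x\<close> and \<open>y\<close> the
      induction step is a polynomial identity.\<close>
    define x y where "x = q ^ k" "y = q ^ d"
    have qs: "q ^ Suc d = q * y" "q ^ Suc n = q * x * y" "q ^ (2 * Suc n) = q^2 * x^2 * y^2"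
      "q ^ Suc (n + k) = q * x^2 * y" "q ^ Suc (n + k + 1) = q^2 * x^2 * y"
      "q ^ Suc (2 * n + 1) = q^2 * x^2 * y^2" "q ^ Suc (2 * n + 2) = q^3 * x^2 * y^2"
      by (simp_all add: n x_y_def power_add power_mult power2_eq_square power3_eq_cube power_mult_distrib algebra_simps)
    have t1: "jacobi_coeff q n k * P (Suc n - k) * P (Suc n + k + 1)
        = (1 - q * y) * (1 - q^2 * x^2 * y) * ((-1) ^ k * q ^ triangular k * D)"
    proof -
      have a: "P (Suc n - k) = (1 - q * y) * P (n - k)" and b: "P (Suc n + k + 1) = (1 - q^2 * x^2 * y) * P (n + k + 1)"
        using P_Suc[of d] P_Suc[of "n + k + 1"] qs by (simp_all add: n)
      have "jacobi_coeff q n k * P (n - k) * P (n + k + 1) = (-1) ^ k * q ^ triangular k * D"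
        unfolding D_def by (rule Suc.IH) (simp add: n)
      from this[symmetric] show ?thesis unfolding a b by (simp only: mult_ac)
    qed
    have t3: "jacobi_coeff q n (Suc k) * P (Suc n - k) * P (Suc n + k + 1)
        = - (1 - y) * (1 - q * y) * q * x * ((-1) ^ k * q ^ triangular k * D)"
    \<comment> \<open>At the edge \<open>d = 0\<close> the coefficient beyond the diagonal is 0,
      matching the factor \<open>1 - y = 0\<close>.\<close>
    proof (cases d)
      case 0
      then show ?thesis using n by (simp add: jacobi_coeff_eq_0 x_y_def)
    next
      case (Suc d')
      have a: "P (Suc n - k) = (1 - q * y) * (1 - y) * P (n - Suc k)"
        using P_Suc[of d] P_Suc[of d'] qs(1) by (simp add: n Suc x_y_def algebra_simps)
      have "jacobi_coeff q n (Suc k) * P (n - Suc k) * P (n + Suc k + 1)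
          = (-1) ^ Suc k * q ^ triangular (Suc k) * D"
        unfolding D_def by (rule Suc.IH) (simp add: n Suc)
      also have "\<dots> = - (q * x * ((-1) ^ k * q ^ triangular k * D))"
        by (simp add: x_y_def power_add mult_ac)
      finally have b: "q * x * ((-1) ^ k * q ^ triangular k * D) = - (jacobi_coeff q n (Suc k) * P (n - Suc k) * P (Suc n + k + 1))"
        by simp
      have "- (1 - y) * (1 - q * y) * q * x * ((-1) ^ k * q ^ triangular k * D)
        = - (1 - y) * (1 - q * y) * (q * x * ((-1) ^ k * q ^ triangular k * D))"
        by (simp only: mult.assoc)
      then show ?thesis unfolding a b by (simp only: mult_ac minus_mult_minus mult_minus_left mult_minus_right minus_minus)
    qed
    \<comment> \<open>The extra factor \<open>x = q ^ k\<close> raises the exponent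
      \<open>triangular (k - 1)\<close> to \<open>triangular k\<close>; it is available because
      \<open>q ^ Suc n = q * x * y\<close>. For \<open>k = 0\<close> the antisymmetry of the
      coefficients provides the minus sign.\<close>
    have t2: "x * ((if k = 0 then - jacobi_coeff q n 0 else jacobi_coeff q n (k - 1)) * P (Suc n - k) * P (Suc n + k + 1))
        = - (1 - q * x^2 * y) * (1 - q^2 * x^2 * y) * ((-1) ^ k * q ^ triangular k * D)"
    proof (cases k)
      case 0
      have a: "P (Suc n) = (1 - q * y) * P n" and b: "P (Suc n + 1) = (1 - q^2 * y) * P (n + 1)"
        using P_Suc[of n] P_Suc[of "n + 1"] qs 0 by (simp_all add: n x_y_def)
      have D: "jacobi_coeff q n 0 * P n * P (n + 1) = D" using Suc.IH[of 0] by (simp add: D_def)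
      have "x * ((if k = 0 then - jacobi_coeff q n 0 else jacobi_coeff q n (k - 1)) * P (Suc n - k) * P (Suc n + k + 1))
          = - jacobi_coeff q n 0 * P (Suc n) * P (Suc n + 1)" using 0 by (simp add: x_y_def)
      also have "\<dots> = - (1 - q * y) * (1 - q^2 * y) * D"
        unfolding a b D[symmetric] by (simp only: mult_ac mult_minus_left mult_minus_right)
      finally show ?thesis using 0 by (simp add: x_y_def)
    next
      case (Suc k')
      have a: "P (Suc n + k + 1) = (1 - q^2 * x^2 * y) * ((1 - q * x^2 * y) * P (n + k' + 1))"
        using P_Suc[of "n + k"] P_Suc[of "n + k + 1"] qs(4,5) by (simp add: Suc)
      have b: "jacobi_coeff q n k' * P (n - k') * P (n + k' + 1) = (-1) ^ k' * q ^ triangular k' * D"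
        unfolding D_def by (rule Suc.IH) (simp add: n Suc)
      have "x * ((if k = 0 then - jacobi_coeff q n 0 else jacobi_coeff q n (k - 1)) * P (Suc n - k) * P (Suc n + k + 1))
          = x * (1 - q^2 * x^2 * y) * (1 - q * x^2 * y) * (jacobi_coeff q n k' * P (n - k') * P (n + k' + 1))"
        unfolding a using Suc by (simp add: mult_ac)
      also have "\<dots> = (1 - q^2 * x^2 * y) * (1 - q * x^2 * y) * (x * ((-1) ^ k' * q ^ triangular k' * D))"
        unfolding b by (simp only: mult_ac)
      also have "x * ((-1) ^ k' * q ^ triangular k' * D) = - ((-1) ^ k * q ^ triangular k * D)"
        by (simp add: Suc x_y_def power_add mult_ac)
      finally show ?thesis by (simp only: mult_ac mult_minus_left mult_minus_right)
    qed
    have PP: "P (2 * Suc n + 1) = (1 - q^3 * x^2 * y^2) * ((1 - q^2 * x^2 * y^2) * D)"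
      using P_Suc[of "2 * n + 1"] P_Suc[of "2 * n + 2"] qs(6,7) by (simp add: D_def)
    define E where "E = (-1) ^ k * q ^ triangular k * D"
    have "jacobi_coeff q (Suc n) k * P (Suc n - k) * P (Suc n + k + 1)
      = (1 + q^2 * x^2 * y^2) * (jacobi_coeff q n k * P (Suc n - k) * P (Suc n + k + 1))
       - q * y * (x * ((if k = 0 then - jacobi_coeff q n 0 else jacobi_coeff q n (k - 1)) * P (Suc n - k) * P (Suc n + k + 1)))
       - q * x * y * (jacobi_coeff q n (Suc k) * P (Suc n - k) * P (Suc n + k + 1))"
      unfolding jacobi_coeff.simps qs by (simp only: algebra_simps)
    also have "\<dots> = (1 - q^3 * x^2 * y^2) * (1 - q^2 * x^2 * y^2) * E"
      unfolding t1 t2 t3 unfolding E_def[symmetric] by (simp add: algebra_simps power2_eq_square power3_eq_cube)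
    also have "\<dots> = (-1) ^ k * q ^ triangular k * P (2 * Suc n + 1)"
      unfolding PP E_def by (simp only: mult_ac)
    finally show ?thesis .
  qed
qed (simp add: P_def)

text \<open>Multiplication by the Euler product turns the Gaussian binomials of
  \<open>jacobi_coeff_prod\<close> into 1 modulo \<open>q^(n+1)\<close>. Multiplying
  \<open>sum_jacobi_coeff\<close> by it therefore gives the cube on one side and Jacobi's series on
  the other.\<close>

theorem euler_fps_cube:
  "(euler_fps ^ 3 :: 'a::idom fps) $ n = (\<Sum>k | triangular k = n. (-1) ^ k * of_nat (2 * k + 1))"
proof -
  define f :: "'a fps" where "f = euler_fps"
  define P :: "nat \<Rightarrow> 'a fps" where "P m = (\<Prod>i\<in>{0<..m}. 1 - fps_X ^ i)" for m
  \<comment> \<open>With this choice \<open>N - k \<ge> n\<close> for all \<open>k \<le> n\<close>,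
    so every truncated product that occurs agrees with \<open>f\<close> modulo
    \<open>q^(n+1)\<close>.\<close>
  define N where "N = 2 * n"
  let ?D = "\<lambda>g. fps_X ^ Suc n dvd (g :: 'a fps)"
  have P: "?D (f - P m)" if "n \<le> m" for m
  proof -
    have "fps_X ^ Suc m dvd f - P m"
      unfolding f_def P_def by (rule euler_fps_cong)
    then show ?thesis using that by (meson Suc_le_mono dvd_trans le_imp_power_dvd)
  qed
  have P0: "P m $ 0 = 1" for m
    
  proof -
    have "(\<Prod>i\<in>A. 1 - fps_X ^ i :: 'a fps) $ 0 = 1" if "finite A" "0 \<notin> A" for A
      using that by (induction A) (auto simp: fps_mult_nth_0)
    then show ?thesis by (simp add: P_def)
  qed
  have f0: "f $ 0 = 1" by (simp add: f_def)
  have coeff: "?D (f * jacobi_coeff fps_X N k - (-1) ^ k * fps_X ^ triangular k)" if "k \<le> N" for k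
  proof -
    have eq: "jacobi_coeff fps_X N k * P (N - k) * P (N + k + 1) = (-1) ^ k * fps_X ^ triangular k * P (2 * N + 1)"
      unfolding P_def by (rule jacobi_coeff_prod) fact
    show ?thesis
    proof (cases "k \<le> n")
      case True
      have 1: "?D (f - P (N - k))" "?D (f - P (N + k + 1))" "?D (f - P (2 * N + 1))"
        using True by (intro P; simp add: N_def)+
      \<comment> \<open>Each truncation in \<open>eq\<close> is exchanged for \<open>f\<close> at
        the cost of a multiple of \<open>q^(n+1)\<close>; the spare factor \<open>f\<close> is
        cancelled afterwards.\<close>
      have "f * (f * jacobi_coeff fps_X N k - (-1) ^ k * fps_X ^ triangular k) =
        (f - P (N - k)) * (f * jacobi_coeff fps_X N k) + P (N - k) * (f - P (N + k + 1)) * jacobi_coeff fps_X N k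
          - (-1) ^ k * fps_X ^ triangular k * (f - P (2 * N + 1))"
        using eq by (simp add: algebra_simps)
      also have "?D \<dots>" using dvd_diff[OF dvd_add[OF dvd_mult2[OF 1(1)] dvd_mult2[OF dvd_mult[OF 1(2)]]] dvd_mult[OF 1(3)]] .
      finally show ?thesis using f0 by (metis fps_X_power_dvd_cancel zero_neq_one)
    next
      case False
      \<comment> \<open>For \<open>k > n\<close> both terms vanish separately modulo
        \<open>q^(n+1)\<close>.\<close>
      then have "Suc n \<le> triangular k" using triangular_ge[of k] by simp
      then have X: "?D ((-1) ^ k * fps_X ^ triangular k)" by (intro dvd_mult le_imp_power_dvd)
      then have "?D (jacobi_coeff fps_X N k * P (N - k) * P (N + k + 1))"
        unfolding eq by (rule dvd_mult2)
      then have "?D ((P (N - k) * P (N + k + 1)) * jacobi_coeff fps_X N k)"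
        by (simp only: mult_ac)
      then have "?D (jacobi_coeff fps_X N k)"
        by (rule fps_X_power_dvd_cancel[rotated]) (simp add: P0 fps_mult_nth_0)
      then show ?thesis by (rule dvd_diff[OF dvd_mult X])
    qed
  qed
  have "?D (f * f ^ 2 - (\<Sum>k\<le>N. of_nat (2 * k + 1) * ((-1) ^ k * fps_X ^ triangular k)))"
  proof -
    have "?D (\<Sum>k\<le>N. of_nat (2 * k + 1) * (f * jacobi_coeff fps_X N k - (-1) ^ k * fps_X ^ triangular k))"
      by (intro dvd_sum dvd_mult coeff) simp
    also have "(\<Sum>k\<le>N. of_nat (2 * k + 1) * (f * jacobi_coeff fps_X N k - (-1) ^ k * fps_X ^ triangular k))
       = f * (\<Sum>k\<le>N. of_nat (2 * k + 1) * jacobi_coeff fps_X N k) - (\<Sum>k\<le>N. of_nat (2 * k + 1) * ((-1) ^ k * fps_X ^ triangular k))"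
      by (simp add: sum_subtractf sum_distrib_left algebra_simps)
    also have "(\<Sum>k\<le>N. of_nat (2 * k + 1) * jacobi_coeff fps_X N k) = P N ^ 2"
      unfolding P_def by (rule sum_jacobi_coeff) simp
    finally have 1: "?D (f * P N ^ 2 - (\<Sum>k\<le>N. of_nat (2 * k + 1) * ((-1) ^ k * fps_X ^ triangular k)))" .
    have "?D (f - P N)" by (rule P) (simp add: N_def)
    then have 2: "?D (f * (f + P N) * (f - P N))" by (rule dvd_mult)
    show ?thesis using dvd_add[OF 1 2] by (simp add: algebra_simps power2_eq_square del: power_Suc)
  qed
  then have "(f ^ 3) $ n = (\<Sum>k\<le>N. of_nat (2 * k + 1) * ((-1) ^ k * fps_X ^ triangular k)) $ n"
    unfolding fps_X_power_dvd_iff by (simp add: power3_eq_cube power2_eq_square mult.assoc)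
  also have "\<dots> = (\<Sum>k\<le>N. if triangular k = n then (-1) ^ k * of_nat (2 * k + 1) else 0)"
  proof -
    have "(of_nat m * ((-1) ^ k * fps_X ^ t) :: 'a fps) $ n = (if t = n then (-1) ^ k * of_nat m else 0)" for m k t
      by (cases "even k") (auto simp flip: fps_of_nat)
    then show ?thesis unfolding fps_sum_nth by (simp only:)
  qed
  also have "\<dots> = (\<Sum>k | triangular k = n. (-1) ^ k * of_nat (2 * k + 1))"
  proof -
    have "{k. triangular k = n} = {k \<in> {..N}. triangular k = n}"
      by (auto simp: N_def intro: order.trans[OF triangular_ge])
    then show ?thesis by (subst sum.inter_filter[symmetric]) simp_all
  qed
  finally show ?thesis unfolding f_def .
qed

section \<open>Seven-dissections\<close>

definition dilate7 :: "'a::idom fps \<Rightarrow> 'a fps" where "dilate7 f = f oo fps_X ^ 7"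

definition slice7 :: "nat \<Rightarrow> 'a::idom fps \<Rightarrow> 'a fps" where "slice7 r f = Abs_fps (\<lambda>n. f $ (7 * n + r))"

lemma dilate7_nth: "dilate7 f $ n = (if 7 dvd n then f $ (n div 7) else 0)"
  unfolding dilate7_def by (rule fps_nth_compose_X_power)

lemma dilate7_add: "dilate7 (f + g) = dilate7 f + dilate7 g"
  and dilate7_diff: "dilate7 (f - g) = dilate7 f - dilate7 g"
  and dilate7_uminus: "dilate7 (- f) = - dilate7 f"
  and dilate7_0: "dilate7 0 = 0"
  by (rule fps_ext; simp add: dilate7_nth)+

lemma dilate7_mult: "dilate7 (f * g) = dilate7 f * dilate7 g"
  and dilate7_power: "dilate7 (f ^ n) = dilate7 f ^ n"
  and dilate7_1: "dilate7 1 = 1"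
  unfolding dilate7_def by (simp_all add: fps_compose_mult_distrib fps_compose_power)

lemma dilate7_numeral: "dilate7 (numeral k) = numeral k"
  by (simp add: dilate7_def numeral_fps_const)

lemma dilate7_X: "dilate7 fps_X = fps_X ^ 7"
  by (simp add: dilate7_def)

lemmas dilate7_simps = dilate7_add dilate7_diff dilate7_uminus dilate7_0 dilate7_1 dilate7_mult dilate7_power dilate7_numeral dilate7_X

lemma dilate7_inject [simp]: "dilate7 f = dilate7 g \<longleftrightarrow> f = g"
proof
  assume *: "dilate7 f = dilate7 g"
  show "f = g"
  proof (rule fps_ext)
    fix n show "f $ n = g $ n" using arg_cong[OF *, of "\<lambda>h. h $ (7 * n)"] by (simp add: dilate7_nth)
  qed
qed simp

lemma slice7_nth [simp]: "slice7 r f $ n = f $ (7 * n + r)"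
  by (simp add: slice7_def)

lemma slice7_add: "slice7 r (f + g) = slice7 r f + slice7 r g"
  and slice7_0: "slice7 r 0 = 0"
  by (rule fps_ext; simp)+

text \<open>Only exponents divisible by 7 occur in \<open>dilate7 h\<close>, so the residue of an
  exponent in the product is decided by \<open>g\<close> alone.\<close>

lemma slice7_mult_dilate7:
  assumes "r < 7"
  shows "slice7 r (g * dilate7 h) = slice7 r g * h"
proof (rule fps_ext)
  fix n
  have "slice7 r (g * dilate7 h) $ n = (\<Sum>i=0..7 * n + r. dilate7 h $ i * g $ (7 * n + r - i))"
    by (simp add: mult.commute[of g] fps_mult_nth)
  also have "\<dots> = (\<Sum>i\<in>(\<lambda>j. 7 * j) ` {0..n}. dilate7 h $ i * g $ (7 * n + r - i))"
    using assms by (intro sum.mono_neutral_right) (auto simp: dilate7_nth elim!: dvdE)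
  also have "\<dots> = (\<Sum>j=0..n. h $ j * g $ (7 * n + r - 7 * j))"
    by (subst sum.reindex) (auto simp: inj_on_def dilate7_nth)
  also have "\<dots> = (\<Sum>j=0..n. h $ j * slice7 r g $ (n - j))"
    by (intro sum.cong refl) (simp add: diff_mult_distrib2)
  also have "\<dots> = (slice7 r g * h) $ n"
    by (simp add: mult.commute[of _ h] fps_mult_nth)
  finally show "slice7 r (g * dilate7 h) $ n = (slice7 r g * h) $ n" .
qed

lemma slice7_X_power: "r < 7 \<Longrightarrow> slice7 r (fps_X ^ k) = (if k mod 7 = r then fps_X ^ (k div 7) else 0)"
proof (rule fps_ext)
  fix n assume "r < 7"
  then have "7 * n + r = k \<longleftrightarrow> k mod 7 = r \<and> n = k div 7" by auto
  then show "slice7 r (fps_X ^ k) $ n = (if k mod 7 = r then fps_X ^ (k div 7) else 0) $ n" by simp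
qed

lemma slice7_eqI:
  assumes "\<And>r. r < 7 \<Longrightarrow> slice7 r f = slice7 r g"
  shows "f = g"
proof (rule fps_ext)
  fix n
  have "slice7 (n mod 7) f $ (n div 7) = slice7 (n mod 7) g $ (n div 7)" using assms[of "n mod 7"] by simp
  then show "f $ n = g $ n" by simp
qed

definition residue_sum :: "'a::idom fps list \<Rightarrow> 'a fps" where
  "residue_sum gs = (\<Sum>r<7. fps_X ^ r * dilate7 (gs ! r))"

lemma residue_sum_expand:
  "residue_sum [g0, g1, g2, g3, g4, g5, g6] = dilate7 g0 + fps_X * dilate7 g1 + fps_X ^ 2 * dilate7 g2
     + fps_X ^ 3 * dilate7 g3 + fps_X ^ 4 * dilate7 g4 + fps_X ^ 5 * dilate7 g5 + fps_X ^ 6 * dilate7 g6"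
  by (simp add: residue_sum_def eval_nat_numeral)

lemma slice7_sum: "slice7 r (\<Sum>i\<in>A. g i) = (\<Sum>i\<in>A. slice7 r (g i))"
  by (induction A rule: infinite_finite_induct) (simp_all add: slice7_add slice7_0)

lemma slice7_residue_sum:
  assumes "r < 7"
  shows "slice7 r (residue_sum gs) = gs ! r"
proof -
  have "slice7 r (residue_sum gs) = (\<Sum>i<7. if i = r then gs ! i else 0)"
    unfolding residue_sum_def slice7_sum
    by (intro sum.cong refl) (use assms in \<open>auto simp: slice7_mult_dilate7 slice7_X_power\<close>)
  then show ?thesis using assms by simp
qed

section \<open>Sections of the Euler product and of its cube\<close>

lemma triangular_mod_7: "triangular k mod 7 \<in> {0, 1, 3, 6}" "triangular k mod 7 = 6 \<longleftrightarrow> k mod 7 = 3"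
proof -
  define i where "i = k mod 7"
  define d where "d = k div 7"
  have k: "k = 7 * d + i" by (simp add: d_def i_def)
  have "k * (k + 1) = i * (i + 1) + 7 * (7 * d * d + 2 * d * i + d)"
    unfolding k by (simp add: algebra_simps)
  \<comment> \<open>As 8 is 1 modulo 7, multiplying by 8 undoes the halving in
    \<open>triangular\<close>.\<close>
  then have "8 * triangular k = 4 * (i * (i + 1)) + 7 * (4 * (7 * d * d + 2 * d * i + d))"
    using double_triangular[of k] by (simp del: mult_Suc_right)
  moreover have "8 * triangular k = triangular k + 7 * triangular k" by simp
  ultimately have *: "triangular k mod 7 = 4 * (i * (i + 1)) mod 7"
    by (metis mod_mult_self2)
  have "i < 7" by (simp add: i_def)
  then have "i = 0 \<or> i = 1 \<or> i = 2 \<or> i = 3 \<or> i = 4 \<or> i = 5 \<or> i = 6" by linarith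
  then have "triangular k mod 7 \<in> {0, 1, 3, 6} \<and> (triangular k mod 7 = 6 \<longleftrightarrow> i = 3)"
    unfolding * by (elim disjE) simp_all
  then show "triangular k mod 7 \<in> {0, 1, 3, 6}" "triangular k mod 7 = 6 \<longleftrightarrow> k mod 7 = 3" by (auto simp: i_def)
qed

lemma triangular_7_3: "triangular (7 * j + 3) = 49 * triangular j + 6"
proof -
  have "2 * triangular (7 * j + 3) = 2 * (49 * triangular j + 6)"
    using double_triangular[of j] double_triangular[of "7 * j + 3"] by (simp add: algebra_simps)
  then show ?thesis by simp
qed

lemma slice7_cube_eq_0:
  assumes "r \<in> {2, 4, 5}"
  shows "slice7 r (euler_fps ^ 3 :: 'a::idom fps) = 0"
proof (rule fps_ext)
  fix n
  have "{k. triangular k = 7 * n + r} = {}"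
  proof safe
    fix k assume "triangular k = 7 * n + r"
    then have "triangular k mod 7 = r" using assms by auto
    then show "k \<in> {}" using triangular_mod_7(1)[of k] assms by auto
  qed
  then show "slice7 r (euler_fps ^ 3 :: 'a fps) $ n = 0 $ n" by (simp only: slice7_nth euler_fps_cube) simp
qed

text \<open>For \<open>k = 7 * j + 3\<close> the weight \<open>2 * k + 1\<close> is
  \<open>7 * (2 * j + 1)\<close> and the sign is opposite to that of \<open>j\<close>. By
  \<open>triangular_7_3\<close> the section is thus Jacobi's series again, in
  \<open>q^7\<close>.\<close>

lemma slice7_6_cube: "slice7 6 (euler_fps ^ 3 :: 'a::idom fps) = - 7 * dilate7 euler_fps ^ 3"
  unfolding dilate7_power[symmetric]
proof (rule fps_ext)
  fix n
  have eq: "{k. triangular k = 7 * n + 6} = (\<lambda>j. 7 * j + 3) ` {j. 7 * triangular j = n}"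
  proof safe
    fix k assume k: "triangular k = 7 * n + 6"
    then have "k mod 7 = 3" using triangular_mod_7(2)[of k] by simp
    then have "k = 7 * (k div 7) + 3" by presburger
    with k triangular_7_3[of "k div 7"] show "k \<in> (\<lambda>j. 7 * j + 3) ` {j. 7 * triangular j = n}"
      by (intro image_eqI[of _ _ "k div 7"]) auto
  qed (simp add: triangular_7_3)
  have "slice7 6 (euler_fps ^ 3 :: 'a fps) $ n = (\<Sum>j | 7 * triangular j = n. (-1) ^ (7 * j + 3) * of_nat (2 * (7 * j + 3) + 1))"
    unfolding slice7_nth euler_fps_cube eq by (subst sum.reindex) (auto simp: inj_on_def)
  also have "\<dots> = - 7 * (\<Sum>j | 7 * triangular j = n. (-1) ^ j * of_nat (2 * j + 1))"
    unfolding sum_distrib_left by (intro sum.cong refl) (auto simp: minus_one_power_iff algebra_simps)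
  also have "(\<Sum>j | 7 * triangular j = n. (-1) ^ j * of_nat (2 * j + 1)) = dilate7 (euler_fps ^ 3 :: 'a fps) $ n"
  proof (cases "7 dvd n")
    case True
    then have "{j. 7 * triangular j = n} = {j. triangular j = n div 7}" by auto
    then show ?thesis using True by (simp only: dilate7_nth euler_fps_cube if_True)
  next
    case False
    then have "{j. 7 * triangular j = n} = {}" by auto
    then show ?thesis using False by (simp add: dilate7_nth)
  qed
  also have "- 7 * dilate7 (euler_fps ^ 3 :: 'a fps) $ n = (- 7 * dilate7 (euler_fps ^ 3)) $ n"
    by (simp add: numeral_fps_const flip: fps_const_neg)
  finally show "slice7 6 (euler_fps ^ 3 :: 'a fps) $ n = (- 7 * dilate7 (euler_fps ^ 3)) $ n" .
qed

lemma pentagonal_mod_7: "(j mod 7) * (3 * (j mod 7) - 1) mod 7 = j * (3 * j - 1) mod (7::int)"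
proof -
  define d i where di: "d = j div 7" "i = j mod 7"
  have "j = 7 * d + i" by (simp add: di)
  then have "j * (3 * j - 1) = i * (3 * i - 1) + 7 * (21 * d * d + 6 * d * i - d)"
    by (simp add: algebra_simps)
  then show ?thesis unfolding di by (simp only: mod_mult_self2)
qed

text \<open>Modulo 7, \<open>j * (3 * j - 1)\<close> takes only the values 0, 2, 3 and 4, while
  doubling 3, 4 and 6 gives 6, 1 and 5.\<close>

lemma slice7_euler_eq_0:
  assumes "r \<in> {3, 4, 6}"
  shows "slice7 r (euler_fps :: 'a::idom fps) = 0"
proof (rule fps_ext)
  fix n
  have "j * (3 * j - 1) \<noteq> 2 * int (7 * n + r)" for j
  proof
    assume *: "j * (3 * j - 1) = 2 * int (7 * n + r)"
    define i where "i = j mod 7"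
    have "i * (3 * i - 1) mod 7 = j * (3 * j - 1) mod 7"
      unfolding i_def by (rule pentagonal_mod_7)
    also have "j * (3 * j - 1) = 2 * int r + 7 * (2 * int n)" unfolding * by simp
    also have "\<dots> mod 7 = 2 * int r mod 7" by (rule mod_mult_self2)
    finally have "i * (3 * i - 1) mod 7 = 2 * int r mod 7" .
    moreover have "i = 0 \<or> i = 1 \<or> i = 2 \<or> i = 3 \<or> i = 4 \<or> i = 5 \<or> i = 6"
      unfolding i_def using pos_mod_bound[of 7 j] pos_mod_sign[of 7 j] by linarith
    ultimately show False using assms by (elim disjE) auto
  qed
  then show "slice7 r (euler_fps :: 'a fps) $ n = 0 $ n" unfolding slice7_nth pentagonal_number by simp
qed

text \<open>Only \<open>j = 7 * i - 1\<close> contributes to this residue. The identity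
  \<open>index\<close> then reproduces the pentagonal series in \<open>q^7\<close>, and the sign
  flips because \<open>7 * i - 1\<close> and \<open>i\<close> have opposite parity.\<close>

lemma slice7_2_euler: "slice7 2 (euler_fps :: 'a::idom fps) = - dilate7 euler_fps"
proof (rule fps_ext)
  fix n
  have index: "(7 * i - 1) * (3 * (7 * i - 1) - 1) = 49 * (i * (3 * i - 1)) + 4" for i :: int
    by (simp add: algebra_simps)
  have eq: "{j. j * (3 * j - 1) = 2 * int (7 * n + 2)} = (\<lambda>i. 7 * i - 1) ` {i. 7 * (i * (3 * i - 1)) = 2 * int n}"
  proof safe
    fix j assume *: "j * (3 * j - 1) = 2 * int (7 * n + 2)"
    define i where "i = j mod 7"
    have "i * (3 * i - 1) mod 7 = j * (3 * j - 1) mod 7"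
      unfolding i_def by (rule pentagonal_mod_7)
    also have "j * (3 * j - 1) = 4 + 7 * (2 * int n)" unfolding * by simp
    also have "\<dots> mod 7 = 4" by (simp only: mod_mult_self2) simp
    finally have "i * (3 * i - 1) mod 7 = 4" .
    moreover have "i = 0 \<or> i = 1 \<or> i = 2 \<or> i = 3 \<or> i = 4 \<or> i = 5 \<or> i = 6"
      unfolding i_def using pos_mod_bound[of 7 j] pos_mod_sign[of 7 j] by linarith
    ultimately have "i = 6" by (elim disjE) simp_all
    then have "j = 7 * ((j + 1) div 7) - 1" unfolding i_def by presburger
    with * index[of "(j + 1) div 7"] show "j \<in> (\<lambda>i. 7 * i - 1) ` {i. 7 * (i * (3 * i - 1)) = 2 * int n}"
      by (intro image_eqI[of _ _ "(j + 1) div 7"]) auto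
  next
    fix i :: int assume "7 * (i * (3 * i - 1)) = 2 * int n"
    then show "(7 * i - 1) * (3 * (7 * i - 1) - 1) = 2 * int (7 * n + 2)" unfolding index by simp
  qed
  have "slice7 2 (euler_fps :: 'a fps) $ n = (\<Sum>i | 7 * (i * (3 * i - 1)) = 2 * int n. if even (7 * i - 1) then 1 else -1)"
    unfolding slice7_nth pentagonal_number eq by (subst sum.reindex) (auto simp: inj_on_def)
  also have "\<dots> = - (\<Sum>i | 7 * (i * (3 * i - 1)) = 2 * int n. if even i then 1 else -1)"
    unfolding sum_negf[symmetric] by (intro sum.cong refl) auto
  also have "(\<Sum>i | 7 * (i * (3 * i - 1)) = 2 * int n. if even i then 1 else -1) = dilate7 (euler_fps :: 'a fps) $ n"
  proof (cases "7 dvd n")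
    case True
    then have "{i. 7 * (i * (3 * i - 1)) = 2 * int n} = {i. i * (3 * i - 1) = 2 * int (n div 7)}" by auto
    then show ?thesis using True by (simp only: dilate7_nth pentagonal_number if_True)
  next
    case False
    have "7 * (i * (3 * i - 1)) \<noteq> 2 * int n" for i
    proof
      assume "7 * (i * (3 * i - 1)) = 2 * int n"
      then have "7 dvd int n" by presburger
      with False show False by (simp add: int_dvd_int_iff[of 7 n, simplified])
    qed
    then show ?thesis using False by (simp add: dilate7_nth)
  qed
  finally show "slice7 2 (euler_fps :: 'a fps) $ n = (- dilate7 euler_fps) $ n" by simp
qed

section \<open>The norm over the seventh roots of unity\<close>

text \<open>The determinant of the 7 by 7 circulant matrix with \<open>u\<close>, \<open>v\<close>,
  \<open>w\<close>, \<open>t\<close> in positions 0, 1, 2, 5, which are the residues of the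
  exponents in the Euler product.\<close>

definition circulant7 :: "'a::comm_ring_1 \<Rightarrow> 'a \<Rightarrow> 'a \<Rightarrow> 'a \<Rightarrow> 'a" where
  "circulant7 u v w t = u^7 + v^7 + w^7 + t^7
     + 14 * (u^3 * w^2 * t^2 + u^2 * v^3 * w^2 + u * v * w^4 * t + v^2 * w^2 * t^3)
     + 7 * (u * v^4 * t^2 + u^2 * v * t^4 + u^4 * v^2 * t)
     - 7 * (u^3 * v * w^3 + u * v^5 * w + u^2 * v^2 * w * t^2 + u^5 * w * t
            + u * w^3 * t^3 + v^3 * w^3 * t + v * w * t^5)"

lemma prod_lessThan_7: "(\<Prod>j<7. f j) = f 0 * f 1 * f 2 * f 3 * f 4 * f 5 * f (6::nat)"
  by (simp add: eval_nat_numeral mult_ac)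

text \<open>The factors for \<open>j\<close> and \<open>7 - j\<close> are multiplied first. Each
  such pair involves \<open>z\<close> only through the periods \<open>c1\<close>, \<open>c2\<close>,
  \<open>c3\<close>, which the three pairs permute cyclically.\<close>

lemma prod_seventh_roots:
  fixes u v w t z :: "'a::idom"
  assumes "1 + z + z^2 + z^3 + z^4 + z^5 + z^6 = 0"
  shows "(\<Prod>j<7. u + z^j * v + z^(2*j) * w + z^(5*j) * t) = circulant7 u v w t"
proof -
  have z7: "z^7 = 1" using assms by algebra
  define c1 c2 c3 where c: "c1 = z + z^6" "c2 = z^2 + z^5" "c3 = z^3 + z^4"
  have c': "c1 + c2 + c3 + 1 = 0" "c1 * c2 = c1 + c3" "c2 * c3 = c2 + c1" "c1 * c3 = c3 + c2"
    "c1^2 = c2 + 2" "c2^2 = c3 + 2" "c3^2 = c1 + 2"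
    using assms z7 unfolding c by algebra+
  define E A B G where E: "E = u^2+v^2+w^2+t^2" "A = u*v+v*w" "B = u*w+u*t" "G = v*t+w*t"
  have p1: "(u + z * v + z^2 * w + z^5 * t) * (u + z^6 * v + z^5 * w + z^2 * t) = E + A*c1 + B*c2 + G*c3"
    using z7 unfolding E c by algebra
  have p2: "(u + z^2 * v + z^4 * w + z^3 * t) * (u + z^5 * v + z^3 * w + z^4 * t) = E + A*c2 + B*c3 + G*c1"
    using z7 unfolding E c by algebra
  have p3: "(u + z^3 * v + z^6 * w + z * t) * (u + z^4 * v + z * w + z^6 * t) = E + A*c3 + B*c1 + G*c2"
    using z7 unfolding E c by algebra
  \<comment> \<open>the norm form of the cubic subfield of the seventh cyclotomic field\<close>
  have N: "(E + A*c1 + B*c2 + G*c3) * (E + A*c2 + B*c3 + G*c1) * (E + A*c3 + B*c1 + G*c2)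
    = E^3 - (A+B+G)*E^2 + E * (3*(A*B+B*G+G*A) - 2*(A^2+B^2+G^2)) + (A^3+B^3+G^3
      + 3*(A^2*B+B^2*G+G^2*A) - 4*(A^2*G+B^2*A+G^2*B) - A*B*G)"
    using c' by algebra
  have red: "z^(7+k) = z^k" for k by (simp add: power_add z7)
  have zs: "z^8 = z" "z^10 = z^3" "z^15 = z" "z^20 = z^6" "z^12=z^5" "z^25=z^4" "z^30 = z^2"
    using red[of 1] red[of 3] red[of 8] red[of 13] red[of 6]
      red[of 5] red[of 18] red[of 11] red[of 4] red[of 23] red[of 16] red[of 9] red[of 2] by simp_all
  have "(\<Prod>j<7. u + z^j * v + z^(2*j) * w + z^(5*j) * t) = (u+v+w+t) *
    ((u + z * v + z^2 * w + z^5 * t) * (u + z^6 * v + z^5 * w + z^2 * t) *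
    ((u + z^2 * v + z^4 * w + z^3 * t) * (u + z^5 * v + z^3 * w + z^4 * t)) *
    ((u + z^3 * v + z^6 * w + z * t) * (u + z^4 * v + z * w + z^6 * t)))"
    unfolding prod_lessThan_7 by (simp add: zs)
  then show ?thesis unfolding p1 p2 p3 unfolding N unfolding E circulant7_def by algebra
qed

text \<open>The value of \<open>circulant7\<close> on the four terms of the dissection: all powers
  of \<open>X\<close> that occur are powers of \<open>Q = X^7\<close>.\<close>

definition norm_poly :: "'a::comm_ring_1 \<Rightarrow> 'a \<Rightarrow> 'a \<Rightarrow> 'a \<Rightarrow> 'a \<Rightarrow> 'a" where
  "norm_poly a b c e Q = a^7 - b^7 * Q + c^7 * Q^5 - e^7 * Q^2
     + 14 * (a^3 * e^2 * c^2 * Q^2 - a^2 * b^3 * e^2 * Q - a * b * e^4 * c * Q^2 + b^2 * e^2 * c^3 * Q^3)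
     + 7 * (a * b^4 * c^2 * Q^2 - a^2 * b * c^4 * Q^3 - a^3 * b * e^3 * Q - a * b^5 * e * Q
            + a^2 * b^2 * e * c^2 * Q^2 + a^4 * b^2 * c * Q + a^5 * e * c * Q + a * e^3 * c^3 * Q^3
            - b^3 * e^3 * c * Q^2 - b * e * c^5 * Q^4)"

lemma circulant7_eq_norm_poly:
  "circulant7 a (- X * b) (- (X^2) * e) (X^5 * c) = norm_poly a b c e (X^7)" for a b c e X :: "'a::idom"
  unfolding circulant7_def norm_poly_def by algebra

text \<open>The relations between the 7-sections of the Euler product, in the variable \<open>Q = q ^ 7\<close>. They parametrise a
  rational curve, so every relation needed below is in the ideal they generate; the cofactors
  in the proofs were found by solving a linear system in each degree.\<close>

locale septic =
  fixes a b c e Q :: "'a::idom"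
  assumes r1: "a * b * c - e ^ 3 = 0"
    and r2: "a * b^2 - a^2 * e + Q * e^2 * c = 0"
    and r3: "a * e^2 - b^2 * e - Q * c^2 * b = 0"
    and r4: "a^2 * c - b * e^2 - Q * c^2 * e = 0"
begin

text \<open>The fourth power of the Euler product, by \<open>euler_power_4\<close>.\<close>

definition "W = a^3 * b + Q * b^3 * c - Q^2 * c^3 * a - 8 * Q * e^4"

text \<open>For the Euler product the left side is \<open>\<phi> ^ 8\<close>, by
  \<open>norm7_euler\<close> and \<open>norm7_euler_product\<close>; its square root
  \<open>\<phi> ^ 4\<close> is thereby expressed in the sections.\<close>

lemma norm_poly_eq_square: "e * norm_poly a b c e Q = W^2" (is "?l = ?r")
proof -
  have "?l - ?r =
   (65*e^5*Q^2 + 10*b^2*c^3*Q^3 - 17*b^3*e*c*Q^2 - 15*a*e*c^3*Q^3 + 55*a*b*e^2*c*Q^2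
      - 2*a^2*b^3*Q + 2*a^3*c^2*Q^2 + 15*a^3*b*e*Q) * (a * b * c - e ^ 3) +
   (24*b^2*e*c^2*Q^2 - 8*b*c^4*Q^3 - 8*b^3*e^2*Q - 24*a*e^2*c^2*Q^2
      - 24*a*b*e^3*Q - 8*a^3*e*c*Q - a^5) * (a * b^2 - a^2 * e + Q * e^2 * c) +
   b^5*Q * (a * e^2 - b^2 * e - Q * c^2 * b) -
   c^5*Q^4 * (a^2 * c - b * e^2 - Q * c^2 * e)"
    unfolding W_def norm_poly_def by algebra
  then have "?l - ?r = 0" unfolding r1 r2 r3 r4 by simp
  then show ?thesis by (simp only: right_minus_eq)
qed

text \<open>The left side is the section of residue 3 of the fifth power, obtained as cube times
  square.\<close>

lemma fifth_power_section:
  "(a^3 + 3*Q*b^2*c - 6*Q*a*c*e) * (2*b*e + Q*c^2) + (Q^2*c^3 + 6*Q*b*c*e - 3*a^2*b) * (b^2 - 2*a*e)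
     + (6*a*b*e - b^3 + 3*Q*c^2*a) * (a^2 - 2*Q*e*c) - 7 * Q * e^5
   = 10 * W * e + 49 * Q * e^5" (is "?l = ?r")
proof -
  have "?l - ?r = - 24*e^2*Q * (a * b * c - e ^ 3) - 4*a*b * (a * b^2 - a^2 * e + Q * e^2 * c)
      - 4*b*c*Q * (a * e^2 - b^2 * e - Q * c^2 * b) + 4*a*c*Q * (a^2 * c - b * e^2 - Q * c^2 * e)"
    unfolding W_def by algebra
  then have "?l - ?r = 0" unfolding r1 r2 r3 r4 by simp
  then show ?thesis by (simp only: right_minus_eq)
qed

text \<open>The product of the cube's sections of residues 0, 1 and 3, as needed for the ninth
  power.\<close>

lemma cube_sections_product:
  "(a^3 + 3*Q*b^2*c - 6*Q*a*c*e) * (Q^2*c^3 + 6*Q*b*c*e - 3*a^2*b) * (6*a*b*e - b^3 + 3*Q*c^2*a)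
   = - 15 * W^2 * e - 147 * Q * W * e^5 - 343 * Q^2 * e^9" (is "?l = ?r")
proof -
  have "?l - ?r =
    (9*b*c^5*Q^4 - 127*e^6*Q^2 + 39*b^2*e*c^3*Q^3 + 102*b^3*e^2*c*Q^2 - 132*a*e^2*c^3*Q^3
      - 166*a*b*e^3*c*Q^2 + 9*a*b^5*Q - 28*a^2*b^2*c^2*Q^2 - 48*a^2*b^3*e*Q + 48*a^3*e*c^2*Q^2
      + 132*a^3*b*e^2*Q - 9*a^5*c*Q) * (a * b * c - e ^ 3)
    + (9*b*e*c^4*Q^3 + 39*b^2*e^2*c^2*Q^2 + 9*b^3*e^3*Q - 39*a*e^3*c^2*Q^2 - 39*a*b*e^4*Q
      + 9*a^3*e^2*c*Q + 3*a^4*b^2) * (a * b^2 - a^2 * e + Q * e^2 * c)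
    + 3*b^4*c^2*Q^2 * (a * e^2 - b^2 * e - Q * c^2 * b)
    + 3*a^2*c^4*Q^3 * (a^2 * c - b * e^2 - Q * c^2 * e)"
    unfolding W_def by algebra
  then have "?l - ?r = 0" unfolding r1 r2 r3 r4 by simp
  then show ?thesis by (simp only: right_minus_eq)
qed

end

section \<open>The dissections over the complex numbers, which contain the seventh roots of
  unity\<close>

abbreviation "\<phi> \<equiv> (euler_fps :: complex fps)"
text \<open>The signs give all four sections constant term 1. By \<open>slice7_2_euler\<close> the
  section of residue 2 is \<open>- \<epsilon>\<close>.\<close>

definition "\<alpha> = slice7 0 \<phi>"
definition "\<beta> = - slice7 1 \<phi>"
definition "\<gamma> = slice7 5 \<phi>"
definition "\<epsilon> = dilate7 \<phi>"

lemma euler_dissection: "\<phi> = dilate7 \<alpha> - fps_X * dilate7 \<beta> - fps_X ^ 2 * dilate7 \<epsilon> + fps_X ^ 5 * dilate7 \<gamma>"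
proof -
  have "\<phi> = residue_sum [\<alpha>, - \<beta>, - \<epsilon>, 0, 0, \<gamma>, 0]"
  proof (rule slice7_eqI)
    fix r :: nat assume "r < 7"
    then have "r = 0 \<or> r = 1 \<or> r = 2 \<or> r = 3 \<or> r = 4 \<or> r = 5 \<or> r = 6" by linarith
    then show "slice7 r \<phi> = slice7 r (residue_sum [\<alpha>, - \<beta>, - \<epsilon>, 0, 0, \<gamma>, 0])"
      unfolding slice7_residue_sum[OF \<open>r < 7\<close>]
      by (elim disjE) (simp_all add: \<alpha>_def \<beta>_def \<gamma>_def \<epsilon>_def slice7_2_euler[unfolded numeral_2_eq_2] slice7_euler_eq_0 eval_nat_numeral)
  qed
  then show ?thesis unfolding residue_sum_expand by (simp add: dilate7_simps)
qed

definition "cube0 = \<alpha>^3 + 3*fps_X*\<beta>^2*\<gamma> - 6*fps_X*\<alpha>*\<gamma>*\<epsilon>"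
definition "cube1 = fps_X^2*\<gamma>^3 + 6*fps_X*\<beta>*\<gamma>*\<epsilon> - 3*\<alpha>^2*\<beta>"
definition "cube3 = 6*\<alpha>*\<beta>*\<epsilon> - \<beta>^3 + 3*fps_X*\<gamma>^2*\<alpha>"

lemma cube_residue_sum: "\<phi> ^ 3 = residue_sum [cube0, cube1, 3 * (\<alpha> * \<beta>^2 - \<alpha>^2 * \<epsilon> + fps_X * \<epsilon>^2 * \<gamma>), cube3,
    3 * (\<alpha> * \<epsilon>^2 - \<beta>^2 * \<epsilon> - fps_X * \<gamma>^2 * \<beta>), 3 * (\<alpha>^2 * \<gamma> - \<beta> * \<epsilon>^2 - fps_X * \<gamma>^2 * \<epsilon>),
    - (\<epsilon> ^ 3) - 6 * (\<alpha> * \<beta> * \<gamma>)]"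
  unfolding residue_sum_expand cube0_def cube1_def cube3_def dilate7_simps by (subst euler_dissection) algebra

text \<open>The sections of \<open>\<phi> ^ 3\<close> are computed twice, from the dissection and
  from Jacobi's formula. Residues 2, 4 and 5 must vanish, which gives the last three relations;
  residue 6 gives \<open>- (\<epsilon> ^ 3) - 6 * (\<alpha> * \<beta> * \<gamma>) = - 7 * \<epsilon>
  ^ 3\<close>, hence the first.\<close>

lemma septic_euler: "septic \<alpha> \<beta> \<gamma> \<epsilon> fps_X"
proof
  have s: "slice7 r (\<phi> ^ 3) = [cube0, cube1, 3 * (\<alpha> * \<beta>^2 - \<alpha>^2 * \<epsilon> + fps_X * \<epsilon>^2 * \<gamma>), cube3,
    3 * (\<alpha> * \<epsilon>^2 - \<beta>^2 * \<epsilon> - fps_X * \<gamma>^2 * \<beta>), 3 * (\<alpha>^2 * \<gamma> - \<beta> * \<epsilon>^2 - fps_X * \<gamma>^2 * \<epsilon>),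
    - (\<epsilon> ^ 3) - 6 * (\<alpha> * \<beta> * \<gamma>)] ! r" if "r < 7" for r
    unfolding cube_residue_sum by (rule slice7_residue_sum) fact
  show "\<alpha> * \<beta>^2 - \<alpha>^2 * \<epsilon> + fps_X * \<epsilon>^2 * \<gamma> = 0"
    using s[of 2] slice7_cube_eq_0[of 2, where 'a=complex] by (simp del: distrib_left_numeral right_diff_distrib_numeral)
  show "\<alpha> * \<epsilon>^2 - \<beta>^2 * \<epsilon> - fps_X * \<gamma>^2 * \<beta> = 0"
    using s[of 4] slice7_cube_eq_0[of 4, where 'a=complex] by (simp del: distrib_left_numeral right_diff_distrib_numeral)
  show "\<alpha>^2 * \<gamma> - \<beta> * \<epsilon>^2 - fps_X * \<gamma>^2 * \<epsilon> = 0"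
    using s[of 5] slice7_cube_eq_0[of 5, where 'a=complex] by (simp del: distrib_left_numeral right_diff_distrib_numeral)
  have "- (\<epsilon> ^ 3) - 6 * (\<alpha> * \<beta> * \<gamma>) = - 7 * \<epsilon> ^ 3"
    using s[of 6] slice7_6_cube[where 'a=complex] by (simp add: \<epsilon>_def)
  then have "6 * (\<alpha> * \<beta> * \<gamma> - \<epsilon> ^ 3) = 0" by (simp add: algebra_simps)
  then show "\<alpha> * \<beta> * \<gamma> - \<epsilon> ^ 3 = 0" by simp
qed

interpretation septic \<alpha> \<beta> \<gamma> \<epsilon> fps_X by (rule septic_euler)

lemma cube_dissection: "\<phi> ^ 3 = dilate7 cube0 + fps_X * dilate7 cube1 + fps_X ^ 3 * dilate7 cube3 - 7 * fps_X ^ 6 * dilate7 \<epsilon> ^ 3"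
proof -
  have "\<phi> ^ 3 = residue_sum [cube0, cube1, 0, cube3, 0, 0, - 7 * \<epsilon> ^ 3]"
    unfolding cube_residue_sum r2 r3 r4 using r1 by (simp add: algebra_simps)
  then show ?thesis unfolding residue_sum_expand dilate7_simps by simp
qed

section \<open>The product of the Euler product over the substitutions of \<open>z * q\<close> for
  \<open>q\<close>\<close>

definition twist :: "complex \<Rightarrow> complex fps \<Rightarrow> complex fps" where "twist z f = f oo (fps_const z * fps_X)"

lemma twist_nth: "twist z f $ n = z ^ n * f $ n"
  by (simp add: twist_def)

lemma twist_add: "twist z (f + g) = twist z f + twist z g"
  and twist_diff: "twist z (f - g) = twist z f - twist z g"
  by (rule fps_ext; simp add: twist_nth algebra_simps)+

lemma twist_1: "twist z 1 = 1"
  and twist_mult: "twist z (f * g) = twist z f * twist z g"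
  and twist_power: "twist z (f ^ n) = twist z f ^ n"
  and twist_X: "twist z fps_X = fps_const z * fps_X"
  by (simp_all add: twist_def fps_compose_mult_distrib fps_compose_power)

lemma twist_dilate7: "z ^ 7 = 1 \<Longrightarrow> twist z (dilate7 f) = dilate7 f"
  by (rule fps_ext) (auto simp: twist_nth dilate7_nth power_mult)

definition zeta7 :: complex where "zeta7 = cis (2 * pi / 7)"

lemma zeta7_7: "zeta7 ^ 7 = 1"
  by (simp add: zeta7_def DeMoivre)

lemma zeta7_sum: "1 + zeta7 + zeta7^2 + zeta7^3 + zeta7^4 + zeta7^5 + zeta7^6 = 0"
proof -
  have "zeta7 \<noteq> 1"
  proof
    assume "zeta7 = 1"
    then have "cos (2 * pi / 7) = 1" by (metis zeta7_def cis.simps(1) one_complex.simps(1))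
    moreover have "cos (2 * pi / 7) < cos 0" by (rule cos_monotone_0_pi) auto
    ultimately show False by simp
  qed
  moreover have "(zeta7 - 1) * (1 + zeta7 + zeta7^2 + zeta7^3 + zeta7^4 + zeta7^5 + zeta7^6) = 0"
    using zeta7_7 by algebra
  ultimately show ?thesis by simp
qed

definition norm7 :: "complex fps \<Rightarrow> complex fps" where "norm7 f = (\<Prod>j<7. twist (zeta7 ^ j) f)"

lemma zeta7_power_7: "(zeta7 ^ j) ^ 7 = 1"
  by (metis power_mult mult.commute zeta7_7 power_one)

lemma norm7_mult: "norm7 (f * g) = norm7 f * norm7 g"
  by (simp add: norm7_def twist_mult prod.distrib)

text \<open>Twisting fixes series in \<open>q^7\<close>, so it only multiplies the four terms of the
  dissection by powers of the root of unity.\<close>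

lemma norm7_euler: "norm7 \<phi> = dilate7 (norm_poly \<alpha> \<beta> \<gamma> \<epsilon> fps_X)"
proof -
  define z where "z = fps_const zeta7"
  have z: "1 + z + z^2 + z^3 + z^4 + z^5 + z^6 = 0"
    unfolding z_def fps_const_power fps_const_add fps_const_1_eq_1[symmetric] zeta7_sum by simp
  have twist: "twist (zeta7 ^ j) \<phi> = dilate7 \<alpha> + z ^ j * (- fps_X * dilate7 \<beta>) + z ^ (2 * j) * (- (fps_X ^ 2) * dilate7 \<epsilon>)
      + z ^ (5 * j) * (fps_X ^ 5 * dilate7 \<gamma>)" for j
    by (subst euler_dissection)
      (simp add: twist_add twist_diff twist_mult twist_power twist_X twist_dilate7[OF zeta7_power_7] z_def power_mult_distrib
        mult.assoc power_mult[symmetric] mult.commute[of j])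
  have "norm7 \<phi> = norm_poly (dilate7 \<alpha>) (dilate7 \<beta>) (dilate7 \<gamma>) (dilate7 \<epsilon>) (fps_X ^ 7)"
    unfolding norm7_def twist unfolding prod_seventh_roots[OF z] by (rule circulant7_eq_norm_poly)
  also have "\<dots> = dilate7 (norm_poly \<alpha> \<beta> \<gamma> \<epsilon> fps_X)"
    unfolding norm_poly_def dilate7_simps ..
  finally show ?thesis .
qed

text \<open>If 7 divides \<open>i\<close>, every twist fixes the factor. Otherwise
  \<open>zeta7 ^ i\<close> is again a primitive root, and the product of \<open>1 - z^j * y\<close>
  over \<open>j < 7\<close> is \<open>1 - y^7\<close>.\<close>

lemma norm7_factor: "norm7 (1 - fps_X ^ i) = (if 7 dvd i then (1 - fps_X ^ i) ^ 7 else 1 - fps_X ^ (7 * i))"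
proof -
  define z where "z = fps_const (zeta7 ^ i)"
  have twist: "twist (zeta7 ^ j) (1 - fps_X ^ i) = 1 + z ^ j * (- (fps_X ^ i)) + z ^ (2 * j) * 0 + z ^ (5 * j) * 0" for j
    by (simp add: twist_diff twist_1 twist_power twist_X power_mult_distrib z_def mult.commute flip: power_mult)
  show ?thesis
  proof (cases "7 dvd i")
    case True
    then have "zeta7 ^ i = 1" by (metis dvdE power_mult zeta7_7 power_one)
    then show ?thesis using True by (simp add: norm7_def twist z_def)
  next
    case False
    define w where "w = zeta7 ^ i"
    have "w = zeta7 ^ (i mod 7)"
      unfolding w_def by (subst (1) div_mult_mod_eq[of i 7, symmetric])
        (simp only: power_add power_mult mult.commute[of _ 7] zeta7_7 power_one mult_1)
    moreover have "i mod 7 = 1 \<or> i mod 7 = 2 \<or> i mod 7 = 3 \<or> i mod 7 = 4 \<or> i mod 7 = 5 \<or> i mod 7 = 6"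
      using False by presburger
    ultimately have "w = zeta7 \<or> w = zeta7^2 \<or> w = zeta7^3 \<or> w = zeta7^4 \<or> w = zeta7^5 \<or> w = zeta7^6"
      by fastforce
    then have "1 + w + w^2 + w^3 + w^4 + w^5 + w^6 = 0"
      by (insert zeta7_sum zeta7_7, elim disjE; hypsubst; algebra)
    then have "1 + z + z^2 + z^3 + z^4 + z^5 + z^6 = 0"
      unfolding z_def w_def[symmetric] fps_const_power fps_const_add fps_const_1_eq_1[symmetric] by simp
    from prod_seventh_roots[OF this, of 1 "- (fps_X ^ i)" 0 0] show ?thesis
      using False unfolding norm7_def twist by (simp add: circulant7_def power_mult[symmetric] mult.commute)
  qed
qed

lemma twist_X_power_dvd: "fps_X ^ n dvd f \<Longrightarrow> fps_X ^ n dvd twist z f"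
  by (simp add: fps_X_power_dvd_iff twist_nth)

lemma dilate7_X_power_dvd: "fps_X ^ n dvd f \<Longrightarrow> fps_X ^ (7 * n) dvd dilate7 f"
  by (auto simp: fps_X_power_dvd_iff dilate7_nth elim!: dvdE)

text \<open>By \<open>norm7_factor\<close> the indices prime to 7 contribute
  \<open>f_7 / f_49\<close> and the multiples of 7 contribute \<open>f_7^7\<close>; here
  \<open>dilate7 \<epsilon>\<close> is \<open>f_49\<close>.\<close>

lemma norm7_euler_product: "dilate7 \<epsilon> * norm7 \<phi> = dilate7 \<phi> ^ 8"
proof -
  define P :: "nat \<Rightarrow> complex fps" where "P m = (\<Prod>i\<in>{0<..m}. 1 - fps_X ^ i)" for m
  have P_Suc: "P (Suc m) = (1 - fps_X ^ Suc m) * P m" for m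
  proof -
    have "{0<..Suc m} = insert (Suc m) {0<..m}" by auto
    then show ?thesis by (simp add: P_def)
  qed
  have P0: "P 0 = 1" by (simp add: P_def)
  \<comment> \<open>Truncating at \<open>7 * K\<close> before and at \<open>K\<close> after a
    dilation makes the identity exact for finite products; each induction step adds seven
    factors.\<close>
  have fin: "dilate7 (dilate7 (P K)) * norm7 (P (7 * K)) = dilate7 (P (7 * K)) * dilate7 (P K) ^ 7" for K
  proof (induction K)
    case 0
    then show ?case by (simp add: P0 dilate7_1 norm7_def twist_1)
  next
    case (Suc K)
    have S: "7 * Suc K = Suc (Suc (Suc (Suc (Suc (Suc (Suc (7 * K)))))))" by simp
    let ?g = "\<lambda>j. 1 - fps_X ^ (7 * K + j) :: complex fps"
    have P7: "P (7 * Suc K) = ?g 7 * ?g 6 * ?g 5 * ?g 4 * ?g 3 * ?g 2 * ?g 1 * P (7 * K)"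
      unfolding S P_Suc by (simp add: mult.assoc eval_nat_numeral)
    have n: "norm7 (?g j) = dilate7 (?g j)" if "j \<in> {1,2,3,4,5,6}" for j
    proof -
      have "\<not> 7 dvd 7 * K + j" using that unfolding dvd_add_right_iff[OF dvd_triv_left] by auto
      then show ?thesis by (simp add: norm7_factor dilate7_simps flip: power_mult)
    qed
    have n': "norm7 (?g 1) = dilate7 (?g 1)" "norm7 (?g 2) = dilate7 (?g 2)" "norm7 (?g 3) = dilate7 (?g 3)"
      "norm7 (?g 4) = dilate7 (?g 4)" "norm7 (?g 5) = dilate7 (?g 5)" "norm7 (?g 6) = dilate7 (?g 6)"
      by (rule n; simp)+
    have g7: "?g 7 = dilate7 (1 - fps_X ^ Suc K)"
      unfolding dilate7_simps power_mult[symmetric] by (simp only: mult_Suc_right add.commute)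
    have n7: "norm7 (?g 7) = dilate7 (1 - fps_X ^ Suc K) ^ 7"
      unfolding norm7_factor g7[symmetric] by simp
    define G where "G = ?g 6 * ?g 5 * ?g 4 * ?g 3 * ?g 2 * ?g 1"
    define h :: "complex fps" where "h = 1 - fps_X ^ Suc K"
    have PG: "P (7 * Suc K) = dilate7 h * G * P (7 * K)"
      unfolding P7 g7 G_def h_def by (simp only: mult.assoc)
    have G: "norm7 G = dilate7 G"
      unfolding G_def norm7_mult dilate7_mult n' ..
    have h: "norm7 (dilate7 h) = dilate7 h ^ 7" using n7 unfolding g7 h_def .
    have Ph: "P (Suc K) = h * P K" unfolding P_Suc h_def ..
    have "dilate7 (dilate7 (P (Suc K))) * norm7 (P (7 * Suc K))
      = dilate7 (dilate7 h) * dilate7 G * dilate7 h ^ 7 * (dilate7 (dilate7 (P K)) * norm7 (P (7 * K)))"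
      unfolding PG Ph norm7_mult G h dilate7_mult by (simp only: mult_ac)
    also have "\<dots> = dilate7 (P (7 * Suc K)) * dilate7 (P (Suc K)) ^ 7"
      unfolding Suc PG Ph dilate7_mult power_mult_distrib by (simp only: mult_ac)
    finally show ?case .
  qed
  have P: "fps_X ^ Suc m dvd \<phi> - P m" for m
    unfolding P_def by (rule euler_fps_cong)
  \<comment> \<open>All operations involved respect congruence modulo \<open>q^m\<close>, so
    \<open>fin\<close> passes to the infinite products.\<close>
  have "fps_X ^ m dvd dilate7 \<epsilon> * norm7 \<phi> - dilate7 \<phi> ^ 8" for m
  proof -
    let ?D = "\<lambda>f g :: complex fps. fps_X ^ m dvd f - g"
    have mult: "?D (f * g) (f' * g')" if "?D f f'" "?D g g'" for f f' g g'
    proof -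
      have "f * g - f' * g' = f * (g - g') + (f - f') * g'" by (simp add: algebra_simps)
      then show ?thesis using that by simp
    qed
    have pow: "?D (f ^ k) (f' ^ k)" if "?D f f'" for f f' k
      by (induction k) (use that mult in auto)
    have twist: "?D (twist z f) (twist z f')" if "?D f f'" for f f' z
      using twist_X_power_dvd[OF that] by (simp add: twist_diff)
    have dilate7: "?D (dilate7 f) (dilate7 f')" if "?D f f'" for f f'
      using dvd_trans[OF le_imp_power_dvd[of m "7 * m" "fps_X :: complex fps"] dilate7_X_power_dvd[OF that]]
      by (simp add: dilate7_diff)
    have nm: "?D (norm7 f) (norm7 f')" if "?D f f'" for f f'
      unfolding norm7_def by (rule prod_cong_dvd) (rule twist[OF that])
    have 1: "?D \<phi> (P k)" if "m \<le> k" for k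
      by (rule dvd_trans[OF le_imp_power_dvd P[of k]]) (use that in simp)
    have m: "m \<le> m" "m \<le> 7 * m" by simp_all
    have "?D (dilate7 \<epsilon> * norm7 \<phi>) (dilate7 (dilate7 (P m)) * norm7 (P (7 * m)))"
      unfolding \<epsilon>_def by (intro mult nm dilate7 1 m)
    then have "fps_X ^ m dvd (dilate7 \<epsilon> * norm7 \<phi> - dilate7 (dilate7 (P m)) * norm7 (P (7 * m)))
        - (dilate7 \<phi> * dilate7 \<phi> ^ 7 - dilate7 (P (7 * m)) * dilate7 (P m) ^ 7)"
      by (rule dvd_diff) (intro mult pow dilate7 1 m)
    then show ?thesis unfolding fin by (simp flip: power_Suc)
  qed
  then have "(dilate7 \<epsilon> * norm7 \<phi> - dilate7 \<phi> ^ 8) $ n = 0" for n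
    using fps_X_power_dvd_iff[of "Suc n"] by blast
  then show ?thesis by (intro fps_ext) (metis eq_iff_diff_eq_0 fps_sub_nth)
qed

section \<open>The sections selected by the operator\<close>

lemma euler_power_8: "\<phi> ^ 8 = W ^ 2"
proof -
  have "dilate7 (\<phi> ^ 8) = dilate7 (W ^ 2)"
    unfolding dilate7_power[of \<phi>] norm7_euler_product[symmetric] norm7_euler dilate7_mult[symmetric] norm_poly_eq_square ..
  then show ?thesis by simp
qed

lemma euler_power_4: "\<phi> ^ 4 = W"
proof -
  have "(\<phi> ^ 4 - W) * (\<phi> ^ 4 + W) = 0" using euler_power_8 by algebra
  moreover have "{0<..1::nat} = {1}" by auto
  \<comment> \<open>The constant term of \<open>\<beta>\<close> is therefore 1, so
    \<open>\<phi> ^ 4 + W\<close> has constant term 2 and the other square root is excluded.\<close>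
  then have "\<phi> $ 1 = - 1" by (simp add: euler_fps_def)
  then have "(\<phi> ^ 4 + W) $ 0 = 2"
    unfolding W_def by (simp add: \<alpha>_def \<beta>_def fps_mult_nth_0 fps_power_zeroth)
  then have "\<phi> ^ 4 + W \<noteq> 0" by (metis fps_zero_nth zero_neq_numeral)
  ultimately show ?thesis by simp
qed

lemma slice7_4_power_9: "slice7 4 (\<phi> ^ 9) = - 90 * (\<phi> ^ 8 * \<epsilon>) - 882 * (fps_X * \<phi> ^ 4 * \<epsilon> ^ 5) - 2401 * (fps_X ^ 2 * \<epsilon> ^ 9)"
proof -
  let ?D6 = "- 7 * \<epsilon> ^ 3" and ?Q = "fps_X :: complex fps"
  have "\<phi> ^ 9 = (\<phi> ^ 3) ^ 3" by simp
  also have "\<dots> = residue_sum [cube0^3 + 6*?Q*cube0*cube1*?D6 + 3*?Q*cube1*cube3^2, 3*cube0^2*cube1 + 3*?Q*cube1^2*?D6 + 3*?Q^2*cube3*?D6^2,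
     3*cube0*cube1^2 + 6*?Q*cube0*cube3*?D6 + ?Q*cube3^3, 3*cube0^2*cube3 + cube1^3 + 6*?Q*cube1*cube3*?D6, 6*(cube0*cube1*cube3) + ?Q^2*?D6^3,
     3*?Q*cube0*?D6^2 + 3*cube1^2*cube3 + 3*?Q*cube3^2*?D6, 3*cube0^2*?D6 + 3*cube0*cube3^2 + 3*?Q*cube1*?D6^2]"
    unfolding cube_dissection residue_sum_expand dilate7_simps by algebra
  \<comment> \<open>Among the residues 0, 1, 3, 6 of the cube only 0 + 1 + 3 = 4 and 6 + 6 + 6 = 18
    are 4 modulo 7. The first arises in six orders; the second carries two factors
    \<open>q^7\<close>.\<close>
  finally have "slice7 4 (\<phi> ^ 9) = 6*(cube0*cube1*cube3) + ?Q^2*?D6^3"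
    by (simp add: slice7_residue_sum)
  also have "cube0*cube1*cube3 = - 15 * W^2 * \<epsilon> - 147 * fps_X * W * \<epsilon>^5 - 343 * fps_X^2 * \<epsilon>^9"
    unfolding cube0_def cube1_def cube3_def by (rule cube_sections_product)
  finally show ?thesis unfolding euler_power_8 euler_power_4 by algebra
qed

lemma slice7_3_power_5: "slice7 3 (\<phi> ^ 5) = 10 * (\<phi> ^ 4 * \<epsilon>) + 49 * (fps_X * \<epsilon> ^ 5)"
proof -
  let ?D6 = "- 7 * \<epsilon> ^ 3" and ?Q = "fps_X :: complex fps"
  let ?S0 = "\<alpha>^2 - 2*?Q*\<epsilon>*\<gamma>" and ?S1 = "- 2*\<alpha>*\<beta>" and ?S2 = "\<beta>^2 - 2*\<alpha>*\<epsilon>" and ?S3 = "2*\<beta>*\<epsilon> + ?Q*\<gamma>^2"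
    and ?S4 = "\<epsilon>^2" and ?S5 = "2*\<alpha>*\<gamma>" and ?S6 = "- 2*\<beta>*\<gamma>"
  have sq: "\<phi> ^ 2 = residue_sum [?S0, ?S1, ?S2, ?S3, ?S4, ?S5, ?S6]"
    unfolding residue_sum_expand dilate7_simps by (subst euler_dissection) algebra
  have "\<phi> ^ 5 = \<phi> ^ 3 * \<phi> ^ 2" by (simp flip: power_add)
  also have "\<dots> = residue_sum [cube0*?S0 + ?Q*(cube1*?S6 + cube3*?S4 + ?D6*?S1), cube0*?S1 + cube1*?S0 + ?Q*(cube3*?S5 + ?D6*?S2),
     cube0*?S2 + cube1*?S1 + ?Q*(cube3*?S6 + ?D6*?S3), cube0*?S3 + cube1*?S2 + cube3*?S0 + ?Q*?D6*?S4, cube0*?S4 + cube1*?S3 + cube3*?S1 + ?Q*?D6*?S5,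
     cube0*?S5 + cube1*?S4 + cube3*?S2 + ?Q*?D6*?S6, cube0*?S6 + cube1*?S5 + cube3*?S3 + ?D6*?S0]"
    unfolding sq cube_dissection residue_sum_expand dilate7_simps by algebra
  \<comment> \<open>Residue 3 arises as 0 + 3, 1 + 2, 3 + 0 and 6 + 4 = 10, the last with one factor
    \<open>q^7\<close>.\<close>
  finally have "slice7 3 (\<phi> ^ 5) = cube0*?S3 + cube1*?S2 + cube3*?S0 + ?Q*?D6*?S4"
    by (simp add: slice7_residue_sum)
  also have "\<dots> = cube0*?S3 + cube1*?S2 + cube3*?S0 - 7*?Q*\<epsilon>^5" by algebra
  also have "\<dots> = 10 * W * \<epsilon> + 49 * fps_X * \<epsilon>^5"
    unfolding cube0_def cube1_def cube3_def by (rule fifth_power_section)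
  finally show ?thesis unfolding euler_power_4 by algebra
qed

lemma slice7_4_F: "slice7 4 (euler_fps ^ 9 * dilate7 euler_fps) =
    - 90 * (euler_fps ^ 9 * dilate7 euler_fps) - 882 * (fps_X * (euler_fps ^ 5 * dilate7 euler_fps ^ 5))
    - 2401 * (fps_X ^ 2 * (\<phi> * dilate7 euler_fps ^ 9))"
  unfolding slice7_mult_dilate7[of 4, simplified] slice7_4_power_9 \<epsilon>_def by algebra

lemma slice7_X_power_mult: "slice7 (r + k) (fps_X ^ k * f) = slice7 r f"
  by (rule fps_ext) (simp add: fps_X_power_mult_nth)

lemma slice7_4_H: "slice7 4 (fps_X * (euler_fps ^ 5 * dilate7 euler_fps ^ 5)) =
    10 * (euler_fps ^ 9 * dilate7 euler_fps) + 49 * (fps_X * (\<phi> ^ 5 * dilate7 euler_fps ^ 5))"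
proof -
  have "slice7 4 (fps_X * (\<phi> ^ 5 * dilate7 \<phi> ^ 5)) = slice7 3 (\<phi> ^ 5 * dilate7 (\<phi> ^ 5))"
    using slice7_X_power_mult[of 3 1] by (simp add: dilate7_power)
  also have "\<dots> = slice7 3 (\<phi> ^ 5) * \<phi> ^ 5" by (rule slice7_mult_dilate7) simp
  finally show ?thesis unfolding slice7_3_power_5 \<epsilon>_def by algebra
qed

lemma slice7_4_G: "slice7 4 (fps_X ^ 2 * (euler_fps * dilate7 euler_fps ^ 9)) = - (\<phi> ^ 9 * dilate7 euler_fps)"
proof -
  have "slice7 4 (fps_X ^ 2 * (\<phi> * dilate7 \<phi> ^ 9)) = slice7 2 (\<phi> * dilate7 (\<phi> ^ 9))"
    using slice7_X_power_mult[of 2 2] by (simp add: dilate7_power)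
  also have "\<dots> = slice7 2 \<phi> * \<phi> ^ 9" by (rule slice7_mult_dilate7) simp
  finally show ?thesis unfolding slice7_2_euler by algebra
qed

section \<open>Generating functions of regular partitions\<close>

definition partition_fps :: "nat set \<Rightarrow> int fps" where
  "partition_fps A = Abs_fps (\<lambda>n. int (card {p. set_mset p \<subseteq> A \<and> sum_mset p = n}))"

lemma finite_partitions:
  fixes A :: "nat set" assumes "A \<subseteq> {0<..}" shows "finite {p. set_mset p \<subseteq> A \<and> sum_mset p = n}"
  by (rule finite_subset[OF _ finite_partitions_le[of n]]) (use assms in \<open>auto simp: is_partition_def\<close>)

text \<open>A partition with parts in \<open>insert x A\<close> either avoids \<open>x\<close> or
  arises by adding one copy of \<open>x\<close> to another such partition.\<close>

lemma partition_fps_insert: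
  assumes "A \<subseteq> {0<..}" "0 < x" "x \<notin> A"
  shows "(1 - fps_X ^ x) * partition_fps (insert x A) = partition_fps A"
proof (rule fps_ext)
  fix n
  let ?S = "\<lambda>A n. {p. set_mset p \<subseteq> A \<and> sum_mset p = (n::nat)}"
  have fin: "finite (?S A k)" "finite (?S (insert x A) k)" for k
    using assms by (auto intro!: finite_partitions)
  have eq: "?S (insert x A) n = ?S A n \<union> (if x \<le> n then add_mset x ` ?S (insert x A) (n - x) else {})"
  proof (intro equalityI subsetI)
    fix p assume p: "p \<in> ?S (insert x A) n"
    show "p \<in> ?S A n \<union> (if x \<le> n then add_mset x ` ?S (insert x A) (n - x) else {})"
    proof (cases "x \<in># p")
      case True
      then obtain p' where "p = add_mset x p'" by (metis multi_member_split)
      then show ?thesis using p by auto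
    next
      case False
      then show ?thesis using p by auto
    qed
  qed (auto split: if_splits)
  have "card (?S (insert x A) n) = card (?S A n) + (if x \<le> n then card (?S (insert x A) (n - x)) else 0)"
  proof (cases "x \<le> n")
    case True
    have disj: "?S A n \<inter> add_mset x ` ?S (insert x A) (n - x) = {}" using assms(3) by (auto simp del: sum_mset.add_mset)
    have "card (?S (insert x A) n) = card (?S A n \<union> add_mset x ` ?S (insert x A) (n - x))"
      by (rule arg_cong[of _ _ card]) (rule eq[unfolded if_P[OF True]])
    also have "\<dots> = card (?S A n) + card (add_mset x ` ?S (insert x A) (n - x))"
      by (rule card_Un_disjoint[OF fin(1) finite_imageI[OF fin(2)] disj])
    also have "card (add_mset x ` ?S (insert x A) (n - x)) = card (?S (insert x A) (n - x))"
      by (rule card_image) (simp add: inj_on_def)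
    finally show ?thesis using True by (simp only: if_True)
  next
    case False
    then have "?S (insert x A) n = ?S A n" using eq[unfolded if_not_P[OF False]] by (simp only: Un_empty_right)
    then show ?thesis using False by (simp only: if_False add_0_right)
  qed
  then show "((1 - fps_X ^ x) * partition_fps (insert x A)) $ n = partition_fps A $ n"
    by (simp add: partition_fps_def left_diff_distrib fps_X_power_mult_nth)
qed

lemma partition_fps_finite:
  assumes "finite A" "A \<subseteq> {0<..}"
  shows "(\<Prod>i\<in>A. 1 - fps_X ^ i) * partition_fps A = 1"
  using assms
proof (induction A)
  case empty
  have "{p. set_mset p \<subseteq> {} \<and> sum_mset p = n} = (if n = 0 then {{#}} else {})" for n :: nat by auto
  then show ?case by (intro fps_ext) (simp add: partition_fps_def del: set_mset_eq_empty_iff)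
next
  case (insert x A)
  then have eq: "(1 - fps_X ^ x) * partition_fps (insert x A) = partition_fps A"
    by (intro partition_fps_insert) auto
  have "(\<Prod>i\<in>insert x A. 1 - fps_X ^ i) * partition_fps (insert x A)
      = (\<Prod>i\<in>A. 1 - fps_X ^ i) * ((1 - fps_X ^ x) * partition_fps (insert x A))"
    using insert.hyps by (simp add: mult_ac)
  also have "\<dots> = 1" unfolding eq using insert by simp
  finally show ?case .
qed

text \<open>Up to degree \<open>N\<close> only parts at most \<open>N\<close> matter. Their factors
  in the Euler product are cancelled by the partition series, leaving the factors outside
  \<open>A\<close>.\<close>

lemma partition_fps_cong:
  assumes "A \<subseteq> {0<..}"
  shows "fps_X ^ Suc N dvd euler_fps * partition_fps A - (\<Prod>i\<in>{0<..N} - A. 1 - fps_X ^ i)"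
proof -
  let ?P = "\<lambda>A. \<Prod>i\<in>A. 1 - fps_X ^ i :: int fps" and ?A = "{0<..N} \<inter> A"
  have "partition_fps A $ n = partition_fps ?A $ n" if "n < Suc N" for n
  proof -
    have "{p. set_mset p \<subseteq> A \<and> sum_mset p = n} = {p. set_mset p \<subseteq> ?A \<and> sum_mset p = n}"
    proof safe
      fix p x assume p: "set_mset p \<subseteq> A" "n = sum_mset p" and x: "x \<in># p"
      have "x \<le> sum_mset p" using x by (auto dest!: multi_member_split)
      with p x assms \<open>n < Suc N\<close> show "x \<in> {0<..N}" "x \<in> A" by auto
    qed auto
    then show ?thesis by (simp add: partition_fps_def)
  qed
  then have 1: "fps_X ^ Suc N dvd partition_fps A - partition_fps ?A"
    by (simp add: fps_X_power_dvd_iff del: power_Suc)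
  have "{0<..N} = ?A \<union> ({0<..N} - A)" by auto
  then have "?P {0<..N} = ?P ?A * ?P ({0<..N} - A)"
    by (subst prod.union_disjoint[symmetric]) auto
  then have "?P {0<..N} * partition_fps ?A = ?P ({0<..N} - A) * (?P ?A * partition_fps ?A)"
    by (simp only: mult_ac)
  also have "?P ?A * partition_fps ?A = 1" by (rule partition_fps_finite) auto
  finally have "?P {0<..N} * partition_fps ?A = ?P ({0<..N} - A)" by (simp only: mult_1_right)
  then have "euler_fps * partition_fps A - ?P ({0<..N} - A)
      = euler_fps * (partition_fps A - partition_fps ?A) + (euler_fps - ?P {0<..N}) * partition_fps ?A"
    by (simp add: algebra_simps)
  also have "fps_X ^ Suc N dvd \<dots>"
    by (intro dvd_add dvd_mult dvd_mult2 1 euler_fps_cong)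
  finally show ?thesis .
qed

lemma fps_eqI_dvd:
  fixes f g :: "'a::comm_ring_1 fps"
  assumes "\<And>n. fps_X ^ n dvd f - g"
  shows "f = g"
proof (rule fps_ext)
  fix n show "f $ n = g $ n"
    using assms[of "Suc n"] by (simp add: fps_X_power_dvd_iff del: power_Suc)
qed

lemma euler_fps_inverse: "euler_fps * partition_fps {0<..} = 1"
proof (rule fps_eqI_dvd)
  fix n
  have "fps_X ^ Suc n dvd euler_fps * partition_fps {0<..} - 1"
    using partition_fps_cong[of "{0<..}" n] by (simp add: Diff_eq_empty_iff[THEN iffD2] subset_eq del: power_Suc)
  then show "fps_X ^ n dvd euler_fps * partition_fps {0<..} - 1"
    by (rule dvd_trans[rotated]) simp
qed

lemma fps_compose_X_power_dvd:
  fixes f :: "'a::idom fps"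
  assumes "fps_X ^ n dvd f" "0 < s"
  shows "fps_X ^ n dvd f oo fps_X ^ s"
  unfolding fps_X_power_dvd_iff fps_nth_compose_X_power
  using assms by (auto simp: fps_X_power_dvd_iff intro: le_less_trans[OF div_le_dividend])

lemma regular_partition_fps:
  assumes "0 < s"
  shows "euler_fps * partition_fps {i. 0 < i \<and> \<not> s dvd i} = euler_fps oo fps_X ^ s"
proof (rule fps_eqI_dvd)
  fix n
  let ?A = "{i. 0 < i \<and> \<not> s dvd i}" and ?P = "\<Prod>i\<in>{0<..n}. 1 - fps_X ^ i :: int fps"
  \<comment> \<open>Truncating at \<open>s * n\<close> leaves exactly the multiples of
    \<open>s\<close>, and their product is the product of the first \<open>n\<close> Euler factors
    evaluated at \<open>q^s\<close>.\<close>
  have "{0<..s * n} - ?A = (*) s ` {0<..n}"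
    using assms by (auto elim!: dvdE)
  then have "(\<Prod>i\<in>{0<..s * n} - ?A. 1 - fps_X ^ i :: int fps) = (\<Prod>i\<in>{0<..n}. 1 - fps_X ^ (s * i))"
    using assms by (simp add: prod.reindex inj_on_def)
  also have "\<dots> = ?P oo fps_X ^ s"
    using assms by (simp add: fps_compose_prod_distrib fps_compose_sub_distrib fps_compose_power[symmetric] power_mult)
  finally have "fps_X ^ Suc (s * n) dvd euler_fps * partition_fps ?A - (?P oo fps_X ^ s)"
    using partition_fps_cong[of ?A "s * n"] by (simp add: subset_eq del: power_Suc)
  then have 1: "fps_X ^ n dvd euler_fps * partition_fps ?A - (?P oo fps_X ^ s)"
    by (rule dvd_trans[rotated]) (intro le_imp_power_dvd, use assms in \<open>simp add: le_Suc_eq\<close>)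
  have "fps_X ^ n dvd euler_fps - ?P"
    by (rule dvd_trans[OF _ euler_fps_cong]) (simp add: le_imp_power_dvd)
  then have 2: "fps_X ^ n dvd (euler_fps oo fps_X ^ s) - (?P oo fps_X ^ s)"
    unfolding fps_compose_sub_distrib[symmetric] using assms by (rule fps_compose_X_power_dvd)
  show "fps_X ^ n dvd euler_fps * partition_fps ?A - (euler_fps oo fps_X ^ s)"
    using dvd_diff[OF 1 2] by simp
qed

lemma B_fps: "Abs_fps (\<lambda>n. int (B s t n)) =
    partition_fps {i. 0 < i \<and> \<not> s dvd i} * partition_fps {i. 0 < i \<and> \<not> t dvd i}"
proof (rule fps_ext)
  fix n
  let ?S = "\<lambda>s n. {p. set_mset p \<subseteq> {i. 0 < i \<and> \<not> s dvd i} \<and> sum_mset p = (n::nat)}"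
  have fin: "finite (?S s k)" for s k by (rule finite_partitions) auto
  have reg: "regular_partition s p \<longleftrightarrow> set_mset p \<subseteq> {i. 0 < i \<and> \<not> s dvd i}" for s p
    unfolding regular_partition_def is_partition_def by blast
  have "regular_bipartitions s t n = (\<Union>i\<in>{0..n}. ?S s i \<times> ?S t (n - i))"
    unfolding regular_bipartitions_def reg[symmetric] by (intro equalityI subsetI; clarsimp)
  then have "B s t n = (\<Sum>i=0..n. card (?S s i \<times> ?S t (n - i)))"
    unfolding B_def by (simp only:) (rule card_UN_disjoint, auto intro: finite_cartesian_product fin)
  then show "Abs_fps (\<lambda>n. int (B s t n)) $ n =
    (partition_fps {i. 0 < i \<and> \<not> s dvd i} * partition_fps {i. 0 < i \<and> \<not> t dvd i}) $ n"
    by (simp add: fps_mult_nth partition_fps_def card_cartesian_product)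
qed

section \<open>Reduction of the generating function modulo 11\<close>

lemma numeral_dvd_fps_iff: "(numeral c :: int fps) dvd f \<longleftrightarrow> (\<forall>n. numeral c dvd f $ n)"
proof
  assume "\<forall>n. numeral c dvd f $ n"
  then have "f = numeral c * Abs_fps (\<lambda>n. f $ n div numeral c)"
    by (intro fps_ext) (simp add: numeral_fps_const)
  then show "numeral c dvd f" by (rule dvdI)
qed (auto simp: numeral_fps_const elim!: dvdE)

lemma freshman_11: "(11::'a::idom) dvd (1 - y) ^ 11 - (1 - y ^ 11)"
proof
  \<comment> \<open>The cofactor has the coefficients \<open>11 choose k\<close> divided by 11, with
    alternating signs.\<close>
  show "(1 - y) ^ 11 - (1 - y ^ 11) = 11 * (- y + 5*y^2 - 15*y^3 + 30*y^4 - 42*y^5 + 42*y^6 - 30*y^7 + 15*y^8 - 5*y^9 + y^10)"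
    by algebra
qed

lemma euler_fps_power_11: "(11 :: int fps) dvd euler_fps ^ 11 - (euler_fps oo fps_X ^ 11)"
  unfolding numeral_dvd_fps_iff
proof
  fix n
  define P where "P = (\<Prod>i\<in>{0<..n}. 1 - fps_X ^ i :: int fps)"
  have P: "fps_X ^ Suc n dvd euler_fps - P"
    unfolding P_def by (rule euler_fps_cong)
  have "P oo fps_X ^ 11 = (\<Prod>i\<in>{0<..n}. 1 - (fps_X ^ i) ^ 11)"
    by (simp add: P_def fps_compose_prod_distrib fps_compose_sub_distrib fps_compose_power[symmetric] mult.commute flip: power_mult)
  moreover have "P ^ 11 = (\<Prod>i\<in>{0<..n}. (1 - fps_X ^ i) ^ 11)"
    by (simp add: P_def prod_power_distrib)
  ultimately have "11 dvd P ^ 11 - (P oo fps_X ^ 11)"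
    by (simp only: prod_cong_dvd freshman_11)
  then have "11 dvd (P ^ 11 - (P oo fps_X ^ 11)) $ n" unfolding numeral_dvd_fps_iff ..
  moreover have "fps_X ^ Suc n dvd euler_fps ^ 11 - P ^ 11"
    by (rule dvd_trans[OF P]) (metis power_diff_sumr2 dvd_triv_left)
  then have "(euler_fps ^ 11) $ n = (P ^ 11) $ n"
    unfolding fps_X_power_dvd_iff by simp
  moreover have "fps_X ^ Suc n dvd (euler_fps oo fps_X ^ 11) - (P oo fps_X ^ 11)"
    unfolding fps_compose_sub_distrib[symmetric] using P by (rule fps_compose_X_power_dvd) simp
  then have "(euler_fps oo fps_X ^ 11) $ n = (P oo fps_X ^ 11) $ n"
    unfolding fps_X_power_dvd_iff by simp
  ultimately show "(11 :: int) dvd (euler_fps ^ 11 - (euler_fps oo fps_X ^ 11)) $ n"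
    by (simp only: fps_sub_nth)
qed

lemma B_7_11_cong: "[int (B 7 11 n) = (euler_fps ^ 9 * dilate7 euler_fps) $ n] (mod 11)"
proof -
  define R where "R = partition_fps {0<..}"
  define b where "b = Abs_fps (\<lambda>n. int (B 7 11 n))"
  have R: "euler_fps * R = 1" unfolding R_def by (rule euler_fps_inverse)
  have "euler_fps ^ 2 * b = (euler_fps * partition_fps {i. 0 < i \<and> \<not> 7 dvd i})
      * (euler_fps * partition_fps {i. 0 < i \<and> \<not> 11 dvd i})"
    unfolding b_def B_fps by (simp only: power2_eq_square mult_ac)
  also have "\<dots> = dilate7 euler_fps * (euler_fps oo fps_X ^ 11)"
    by (simp add: regular_partition_fps dilate7_def)
  finally have "euler_fps ^ 2 * b = dilate7 euler_fps * (euler_fps oo fps_X ^ 11)" .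
  \<comment> \<open>Multiplication by \<open>R ^ 2\<close> divides by \<open>euler_fps ^ 2\<close>;
    the two series then differ only by \<open>euler_fps ^ 11\<close> in place of its dilation by
    11.\<close>
  then have "b - euler_fps ^ 9 * dilate7 euler_fps
     = - (R ^ 2 * dilate7 euler_fps) * (euler_fps ^ 11 - (euler_fps oo fps_X ^ 11))"
    using R by algebra
  then have "11 dvd b - euler_fps ^ 9 * dilate7 euler_fps"
    using euler_fps_power_11 by (metis dvd_mult)
  then have "11 dvd (b - euler_fps ^ 9 * dilate7 euler_fps) $ n" unfolding numeral_dvd_fps_iff ..
  then show ?thesis by (simp add: b_def cong_iff_dvd_diff)
qed

section \<open>The operator on coefficients modulo 11\<close>

text \<open>The dissections are identities over the complex numbers, while congruences need
  integers. This embedding is injective on coefficients and carries the identities back.\<close>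

definition complex_fps :: "int fps \<Rightarrow> complex fps" where "complex_fps f = Abs_fps (\<lambda>n. of_int (f $ n))"

lemma complex_fps_nth [simp]: "complex_fps f $ n = of_int (f $ n)"
  by (simp add: complex_fps_def)

lemma complex_fps_mult: "complex_fps (f * g) = complex_fps f * complex_fps g"
  and complex_fps_diff: "complex_fps (f - g) = complex_fps f - complex_fps g"
  and complex_fps_1: "complex_fps 1 = 1"
  and complex_fps_X: "complex_fps fps_X = fps_X"
  and complex_fps_dilate7: "complex_fps (dilate7 f) = dilate7 (complex_fps f)"
  by (rule fps_ext; simp add: fps_mult_nth dilate7_nth)+

lemma complex_fps_power: "complex_fps (f ^ n) = complex_fps f ^ n"
  by (induction n) (simp_all add: complex_fps_mult complex_fps_1)

lemma complex_fps_prod: "complex_fps (prod h A) = (\<Prod>i\<in>A. complex_fps (h i))"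
  by (induction A rule: infinite_finite_induct) (simp_all add: complex_fps_mult complex_fps_1)

lemma complex_fps_euler: "complex_fps euler_fps = euler_fps"
proof (rule fps_ext)
  fix n
  have "complex_fps (\<Prod>i\<in>{0<..n}. 1 - fps_X ^ i) = (\<Prod>i\<in>{0<..n}. 1 - fps_X ^ i)"
    by (simp only: complex_fps_prod complex_fps_diff complex_fps_1 complex_fps_power complex_fps_X)
  from arg_cong[OF this, of "\<lambda>f. f $ n"] show "complex_fps euler_fps $ n = euler_fps $ n"
    by (simp add: euler_fps_def)
qed

definition F7 :: "'a::idom fps" where "F7 = euler_fps ^ 9 * dilate7 euler_fps"
definition H7 :: "'a::idom fps" where "H7 = fps_X * (euler_fps ^ 5 * dilate7 euler_fps ^ 5)"
definition G7 :: "'a::idom fps" where "G7 = fps_X ^ 2 * (euler_fps * dilate7 euler_fps ^ 9)"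

lemma complex_fps_FHG: "complex_fps F7 = F7" "complex_fps H7 = H7" "complex_fps G7 = G7"
  by (simp_all only: F7_def H7_def G7_def complex_fps_mult complex_fps_power complex_fps_dilate7 complex_fps_euler complex_fps_X)

lemma F7_step: "(F7 :: int fps) $ (7 * n + 4) = - 90 * F7 $ n - 882 * H7 $ n - 2401 * G7 $ n" (is ?F)
  and H7_step: "(H7 :: int fps) $ (7 * n + 4) = 10 * F7 $ n + 49 * H7 $ n" (is ?H)
  and G7_step: "(G7 :: int fps) $ (7 * n + 4) = - (F7 $ n)" (is ?G)
proof -
  have c: "of_int ((F7 :: int fps) $ k) = (F7 :: complex fps) $ k"
    "of_int ((H7 :: int fps) $ k) = (H7 :: complex fps) $ k"
    "of_int ((G7 :: int fps) $ k) = (G7 :: complex fps) $ k" for k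
    by (metis complex_fps_nth complex_fps_FHG)+
  have "slice7 4 F7 $ n = (- 90 * F7 - 882 * H7 - 2401 * G7 :: complex fps) $ n"
    unfolding F7_def H7_def G7_def slice7_4_F ..
  then have "of_int ((F7 :: int fps) $ (7 * n + 4)) = (of_int (- 90 * F7 $ n - 882 * H7 $ n - 2401 * G7 $ n) :: complex)"
    by (simp add: c numeral_fps_const flip: fps_const_neg)
  then show ?F by (simp only: of_int_eq_iff)
  have "slice7 4 H7 $ n = (10 * F7 + 49 * H7 :: complex fps) $ n"
    unfolding F7_def H7_def slice7_4_H ..
  then have "of_int ((H7 :: int fps) $ (7 * n + 4)) = (of_int (10 * F7 $ n + 49 * H7 $ n) :: complex)"
    by (simp add: c numeral_fps_const)
  then show ?H by (simp only: of_int_eq_iff)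
  have "slice7 4 G7 $ n = (- F7 :: complex fps) $ n"
    unfolding F7_def G7_def slice7_4_G ..
  then have "of_int ((G7 :: int fps) $ (7 * n + 4)) = (of_int (- (F7 $ n)) :: complex)"
    by (simp add: c)
  then show ?G by (simp only: of_int_eq_iff)
qed

text \<open>The factor \<open>q^2\<close> moves the residues 6, 3, 4, absent from the Euler product,
  to 1, 5, 6; the dilated factor leaves residues alone.\<close>

lemma G7_nonresidue:
  assumes "k \<in> {1, 5, 6}"
  shows "G7 $ (7 * n + k) = 0"
proof -
  have "slice7 k (fps_X ^ 2 * euler_fps :: 'a fps) = 0"
  proof (rule fps_ext)
    fix m
    have e: "(euler_fps :: 'a fps) $ (7 * m + r) = 0" if "r \<in> {3, 4, 6}" for m r
      using arg_cong[OF slice7_euler_eq_0[OF that, where 'a='a], of "\<lambda>f. f $ m"] by simp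
    show "slice7 k (fps_X ^ 2 * euler_fps :: 'a fps) $ m = 0 $ m"
    proof (cases "k = 1")
      case True
      \<comment> \<open>Here \<open>7 * m + 1 - 2 = 7 * (m - 1) + 6\<close>; for
        \<open>m = 0\<close> the coefficient is 0 because of the factor \<open>q^2\<close>.\<close>
      then show ?thesis using e[of 6 "m - 1"] by (cases m) (simp_all add: fps_X_power_mult_nth add.commute)
    next
      case False
      then show ?thesis using assms e[of 3 m] e[of 4 m] by (auto simp: fps_X_power_mult_nth add.commute)
    qed
  qed
  then have "slice7 k (fps_X ^ 2 * euler_fps * dilate7 (euler_fps ^ 9) :: 'a fps) = 0"
    using assms by (subst slice7_mult_dilate7) auto
  from arg_cong[OF this, of "\<lambda>f. f $ n"] show ?thesis
    by (simp add: G7_def dilate7_power mult.assoc)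
qed

section \<open>Iteration of the index map\<close>

definition next7 :: "nat \<Rightarrow> nat" where "next7 n = 7 * n + 4"

text \<open>The affine map fixes -2/3, so it multiplies \<open>3 * n + 2\<close> by 7.\<close>

lemma next7_iterate: "3 * (next7 ^^ k) n + 2 = 7 ^ k * (3 * n + 2)"
  by (induction k) (simp_all add: next7_def)

lemma next7_closed: "(next7 ^^ k) n = 7 ^ k * n + (2 * 7 ^ k - 2) div 3"
proof -
  have "3 * (next7 ^^ k) n = 3 * (7 ^ k * n) + (2 * 7 ^ k - 2)"
    using next7_iterate[of k n] by (simp add: algebra_simps)
  then show ?thesis by presburger
qed

text \<open>Coordinates modulo 11 of the \<open>k\<close>-th image of \<open>F7\<close> under the
  operator, relative to \<open>F7\<close>, \<open>H7\<close>, \<open>G7\<close>.\<close>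

definition F7_coords :: "nat \<Rightarrow> int \<Rightarrow> int \<Rightarrow> int \<Rightarrow> bool" where
  "F7_coords k x y z \<longleftrightarrow> (\<forall>n. [F7 $ ((next7 ^^ k) n) = x * F7 $ n + y * H7 $ n + z * G7 $ n] (mod 11))"

text \<open>The coefficients in the hypotheses \<open>c\<close> are -90, -882, -2401, 10, 49 and -1
  reduced modulo 11. The new step is taken innermost, at \<open>next7 n\<close>, where the three
  step formulas apply.\<close>

lemma F7_coords_Suc:
  assumes "F7_coords k x y z" "k' = Suc k"
    and c: "[9 * x + 10 * y + 10 * z = x'] (mod 11)" "[9 * x + 5 * y = y'] (mod 11)" "[8 * x = z'] (mod 11)"
  shows "F7_coords k' x' y' z'"
  unfolding F7_coords_def \<open>k' = Suc k\<close>
proof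
  fix n
  let ?f = "(F7 :: int fps) $ n" and ?h = "(H7 :: int fps) $ n" and ?g = "(G7 :: int fps) $ n"
  have "[(F7 :: int fps) $ ((next7 ^^ Suc k) n) = x * (- 90 * ?f - 882 * ?h - 2401 * ?g) + y * (10 * ?f + 49 * ?h) + z * (- ?f)] (mod 11)"
    using assms(1)[unfolded F7_coords_def, rule_format, of "next7 n"]
    by (simp only: funpow_Suc_right o_apply next7_def[of n] F7_step H7_step G7_step)
  also have "[x * (- 90 * ?f - 882 * ?h - 2401 * ?g) + y * (10 * ?f + 49 * ?h) + z * (- ?f) =
     (9 * x + 10 * y + 10 * z) * ?f + (9 * x + 5 * y) * ?h + 8 * x * ?g] (mod 11)"
    unfolding cong_iff_dvd_diff
    by (rule dvdI[of _ _ "- 9 * x * ?f - 81 * x * ?h - 219 * x * ?g + 4 * y * ?h - z * ?f"]) (simp add: algebra_simps)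
  also have "[(9 * x + 10 * y + 10 * z) * ?f + (9 * x + 5 * y) * ?h + 8 * x * ?g = x' * ?f + y' * ?h + z' * ?g] (mod 11)"
    by (intro cong_add cong_mult cong_refl c)
  finally show "[F7 $ ((next7 ^^ Suc k) n) = x' * ?f + y' * ?h + z' * ?g] (mod 11)" .
qed

lemma F7_coords_11: "F7_coords 11 0 0 8"
proof -
  have "F7_coords 0 1 0 0" by (simp add: F7_coords_def)
  then have "F7_coords 1 9 9 8" by (rule F7_coords_Suc) (simp_all add: cong_def)
  then have "F7_coords 2 9 5 6" by (rule F7_coords_Suc) (simp_all add: cong_def)
  then have "F7_coords 3 4 7 6" by (rule F7_coords_Suc) (simp_all add: cong_def)
  then have "F7_coords 4 1 5 10" by (rule F7_coords_Suc) (simp_all add: cong_def)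
  then have "F7_coords 5 5 1 8" by (rule F7_coords_Suc) (simp_all add: cong_def)
  then have "F7_coords 6 3 6 7" by (rule F7_coords_Suc) (simp_all add: cong_def)
  then have "F7_coords 7 3 2 2" by (rule F7_coords_Suc) (simp_all add: cong_def)
  then have "F7_coords 8 1 4 2" by (rule F7_coords_Suc) (simp_all add: cong_def)
  then have "F7_coords 9 3 7 8" by (rule F7_coords_Suc) (simp_all add: cong_def)
  then have "F7_coords 10 1 7 2" by (rule F7_coords_Suc) (simp_all add: cong_def)
  then show ?thesis by (rule F7_coords_Suc) (simp_all add: cong_def)
qed

text \<open>The operator sends \<open>G7\<close> to \<open>- F7\<close>, and -8 is 3 modulo
  11.\<close>

lemma F7_coords_12: "F7_coords 12 3 0 0"
  using F7_coords_11 by (rule F7_coords_Suc) (simp_all add: cong_def)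

lemma F7_12m: "[(F7 :: int fps) $ ((next7 ^^ (12 * m)) n) = 3 ^ m * F7 $ n] (mod 11)"
proof (induction m)
  case (Suc m)
  have "[(F7 :: int fps) $ ((next7 ^^ 12) ((next7 ^^ (12 * m)) n)) = 3 * F7 $ ((next7 ^^ (12 * m)) n)] (mod 11)"
    using F7_coords_12[unfolded F7_coords_def] by simp
  also have "[3 * F7 $ ((next7 ^^ (12 * m)) n) = 3 * (3 ^ m * F7 $ n :: int)] (mod 11)"
    by (intro cong_mult cong_refl Suc)
  finally show ?case by (simp only: mult_Suc_right funpow_add o_apply power_Suc mult.assoc)
qed simp

theorem theorem1p2:
  fixes n m :: nat
  shows "[B 7 11 (7 ^ (12 * m) * n + (2 * 7 ^ (12 * m) - 2) div 3) = 3 ^ m * B 7 11 n] (mod 11)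
       \<and> (\<forall>k \<in> {1, 5, 6}.
            [B 7 11 (7 ^ (12 * m + 11) * (7 * n + k) + (2 * 7 ^ (12 * m + 11) - 2) div 3) = 0] (mod 11))"
proof (intro conjI ballI)
  have B: "[int (B 7 11 n) = F7 $ n] (mod 11)" for n
    unfolding F7_def by (rule B_7_11_cong)
  have "[int (B 7 11 ((next7 ^^ (12 * m)) n)) = 3 ^ m * F7 $ n] (mod 11)"
    using B F7_12m by (rule cong_trans)
  also have "[3 ^ m * F7 $ n = 3 ^ m * int (B 7 11 n)] (mod 11)"
    by (intro cong_mult cong_refl cong_sym[OF B])
  finally have "[int (B 7 11 ((next7 ^^ (12 * m)) n)) = int (3 ^ m * B 7 11 n)] (mod int 11)" by simp
  then show "[B 7 11 (7 ^ (12 * m) * n + (2 * 7 ^ (12 * m) - 2) div 3) = 3 ^ m * B 7 11 n] (mod 11)"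
    unfolding cong_int_iff next7_closed .
next
  fix k :: nat assume k: "k \<in> {1, 5, 6}"
  \<comment> \<open>The first eleven steps reduce \<open>F7\<close> to \<open>8 * G7\<close> at
    \<open>7 * n + k\<close>, which is 0; the remaining \<open>12 * m\<close> steps only multiply by
    \<open>3 ^ m\<close>.\<close>
  let ?n = "(next7 ^^ 11) (7 * n + k)"
  have "[int (B 7 11 ((next7 ^^ (12 * m)) ?n)) = 3 ^ m * F7 $ ?n] (mod 11)"
    using B_7_11_cong F7_12m unfolding F7_def by (rule cong_trans)
  also have "[3 ^ m * F7 $ ?n = 3 ^ m * (0 * F7 $ (7 * n + k) + 0 * H7 $ (7 * n + k) + 8 * G7 $ (7 * n + k) :: int)] (mod 11)"
    by (intro cong_mult cong_refl F7_coords_11[unfolded F7_coords_def, rule_format])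
  also have "3 ^ m * (0 * F7 $ (7 * n + k) + 0 * H7 $ (7 * n + k) + 8 * G7 $ (7 * n + k)) = int 0"
    by (simp add: G7_nonresidue[OF k])
  finally have "[int (B 7 11 ((next7 ^^ (12 * m + 11)) (7 * n + k))) = int 0] (mod int 11)"
    by (simp add: funpow_add)
  then show "[B 7 11 (7 ^ (12 * m + 11) * (7 * n + k) + (2 * 7 ^ (12 * m + 11) - 2) div 3) = 0] (mod 11)"
    unfolding cong_int_iff next7_closed .
qed

end
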